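(* Let $(X,T)$ be a minimal topological dynamical system, with maximal equicontinuous factor map $\pi_{eq}:X\to X_{eq}$. The following statements are equivalent: (1) $(X,T)$ is diam-mean equicontinuous; (2) $(X,T)$ is Banach diam-mean equicontinuous; (3) $\pi_{eq}:X\to X_{eq}$ is regular.
   Context: A topological dynamical system (t.d.s.) $(X,T)$ is a compact metric space $X$ with a continuous map $T:X\to X$. It is minimal if every forward orbit is dense in $X$. It is equicontinuous if the family $\{T^n:n\in\mathbb{Z}_+\}$ is equicontinuous. A factor of $(X,T)$ is a t.d.s. $(X',T')$ with a continuous surjection $f:X\to X'$ (the factor map) satisfying $f\circ T=T'\circ f$. The maximal equicontinuous factor $(X_{eq},T_{eq})$, with factor map $\pi_{eq}$, is the (unique up to conjugacy) equicontinuous factor of $(X,T)$ such that every other equicontinuous factor of $(X,T)$ is a factor of it. If $(X,T)$ is minimal, $(X_{eq},T_{eq})$ is minimal and uniquely ergodic; $\nu_{eq}$ denotes its unique invariant Borel probability measure. $\pi_{eq}$ is regular if $\nu_{eq}(\{y\in X_{eq}:|\pi_{eq}^{-1}(y)|=1\})=1$. $B_\delta(x)$ is the open ball of radius $\delta$ about $x$. A point $x\in X$ is a diam-mean equicontinuity point if for every $\varepsilon>0$ there is $\delta>0$ with $\limsup_{N\to\infty}\frac1N\sum_{i=1}^N\operatorname{diam}(T^iB_\delta(x))<\varepsilon$. It is a Banach diam-mean equicontinuity point if for every $\varepsilon>0$ there is $\delta>0$ with $\limsup_{N-M\to\infty}\frac1{N-M}\sum_{i=M+1}^N\operatorname{diam}(T^iB_\delta(x))<\varepsilon$,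 where $\limsup_{N-M\to\infty}$ means $\limsup_{n\to\infty}\sup_{N-M=n}$ over integers $N>M\ge0$. $(X,T)$ is diam-mean equicontinuous (resp. Banach diam-mean equicontinuous) if every $x\in X$ is a diam-mean equicontinuity point (resp. a Banach diam-mean equicontinuity point). *)

theory Defs
  imports "HOL-Probability.Probability"
begin

definition tds :: "'a::metric_space set \<Rightarrow> ('a \<Rightarrow> 'a) \<Rightarrow> bool" where
  "tds X T \<longleftrightarrow> compact X \<and> continuous_on X T \<and> T ` X \<subseteq> X"

definition minimal_tds :: "'a::metric_space set \<Rightarrow> ('a \<Rightarrow> 'a) \<Rightarrow> bool" where
  "minimal_tds X T \<longleftrightarrow> tds X T \<and> (\<forall>x\<in>X. X \<subseteq> closure (range (\<lambda>n. (T ^^ n) x)))"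

definition equicontinuous_tds :: "'a::metric_space set \<Rightarrow> ('a \<Rightarrow> 'a) \<Rightarrow> bool" where
  "equicontinuous_tds X T \<longleftrightarrow> tds X T \<and>
     (\<forall>x\<in>X. \<forall>\<epsilon>>0. \<exists>\<delta>>0. \<forall>y\<in>X. dist x y < \<delta> \<longrightarrow> (\<forall>n. dist ((T ^^ n) x) ((T ^^ n) y) < \<epsilon>))"

definition factor_map ::
  "'a::metric_space set \<Rightarrow> ('a \<Rightarrow> 'a) \<Rightarrow> 'b::metric_space set \<Rightarrow> ('b \<Rightarrow> 'b) \<Rightarrow> ('a \<Rightarrow> 'b) \<Rightarrow> bool" where
  "factor_map X T Y S f \<longleftrightarrow> tds X T \<and> tds Y S \<and>
     continuous_on X f \<and> f ` X = Y \<and> (\<forall>x\<in>X. f (T x) = S (f x))"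

text \<open>
  HOL cannot quantify over types inside a formula, so the competing equicontinuous factors
  \<open>(Z, R)\<close> below are taken in the single type \<open>nat \<Rightarrow> real\<close> (with the product metric of
  \<^theory>\<open>HOL-Analysis.Function_Metric\<close>). Nothing is lost: every compact metric space embeds there,
  and lemma \<open>maximal_equicontinuous_factorD\<close> derives the universal property for factors
  in an arbitrary metric type.

  The map from \<open>Y\<close> onto \<open>Z\<close> is not required to commute with the factor maps from \<open>X\<close>; only
  being a factor is asked for.
\<close>

definition maximal_equicontinuous_factor ::
  "'a::metric_space set \<Rightarrow> ('a \<Rightarrow> 'a) \<Rightarrow> 'b::metric_space set \<Rightarrow> ('b \<Rightarrow> 'b) \<Rightarrow> ('a \<Rightarrow> 'b) \<Rightarrow> bool" where
  "maximal_equicontinuous_factor X T Y S f \<longleftrightarrow>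
     factor_map X T Y S f \<and> equicontinuous_tds Y S \<and>
     (\<forall>(Z :: (nat \<Rightarrow> real) set) R g. factor_map X T Z R g \<and> equicontinuous_tds Z R
        \<longrightarrow> (\<exists>h. factor_map Y S Z R h))"

definition invariant_borel_prob :: "'b::metric_space set \<Rightarrow> ('b \<Rightarrow> 'b) \<Rightarrow> 'b measure \<Rightarrow> bool" where
  "invariant_borel_prob Y S \<nu> \<longleftrightarrow>
     prob_space \<nu> \<and> sets \<nu> = sets (restrict_space borel Y) \<and> distr \<nu> \<nu> S = \<nu>"

text \<open>
  Here \<open>\<nu>\<close> is meant to be the unique invariant Borel probability measure of the factor.
  Note that \<open>card A = 1\<close> excludes infinite \<open>A\<close>.
\<close>

definition regular_factor_map ::
  "'a set \<Rightarrow> 'b set \<Rightarrow> 'b measure \<Rightarrow> ('a \<Rightarrow> 'b) \<Rightarrow> bool" where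
  "regular_factor_map X Y \<nu> f \<longleftrightarrow> measure \<nu> {y \<in> Y. card {x \<in> X. f x = y} = 1} = 1"

text \<open>
  The space is a subset \<open>X\<close> of the ambient type, so the ball in the space is \<open>ball x \<delta> \<inter> X\<close>.
\<close>

definition diam_mean_equicontinuity_point ::
  "'a::metric_space set \<Rightarrow> ('a \<Rightarrow> 'a) \<Rightarrow> 'a \<Rightarrow> bool" where
  "diam_mean_equicontinuity_point X T x \<longleftrightarrow>
     (\<forall>\<epsilon>::real. \<epsilon> > 0 \<longrightarrow> (\<exists>\<delta>>0.
        limsup (\<lambda>N. ereal ((1 / real N) * (\<Sum>i=1..N. diameter ((T ^^ i) ` (ball x \<delta> \<inter> X)))))
          < ereal \<epsilon>))"

definition Banach_diam_mean_equicontinuity_point ::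
  "'a::metric_space set \<Rightarrow> ('a \<Rightarrow> 'a) \<Rightarrow> 'a \<Rightarrow> bool" where
  "Banach_diam_mean_equicontinuity_point X T x \<longleftrightarrow>
     (\<forall>\<epsilon>::real. \<epsilon> > 0 \<longrightarrow> (\<exists>\<delta>>0.
        limsup (\<lambda>n. SUP (M, N) \<in> {(M, N). M < N \<and> N - M = n}.
            ereal ((1 / real (N - M)) * (\<Sum>i=M+1..N. diameter ((T ^^ i) ` (ball x \<delta> \<inter> X)))))
          < ereal \<epsilon>))"

definition diam_mean_equicontinuous :: "'a::metric_space set \<Rightarrow> ('a \<Rightarrow> 'a) \<Rightarrow> bool" where
  "diam_mean_equicontinuous X T \<longleftrightarrow> (\<forall>x\<in>X. diam_mean_equicontinuity_point X T x)"

definition Banach_diam_mean_equicontinuous :: "'a::metric_space set \<Rightarrow> ('a \<Rightarrow> 'a) \<Rightarrow> bool" where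
  "Banach_diam_mean_equicontinuous X T \<longleftrightarrow> (\<forall>x\<in>X. Banach_diam_mean_equicontinuity_point X T x)"

lemma compact_embeds_nat_real:
  fixes Z :: "'c::metric_space set"
  assumes "compact Z"
  obtains e :: "'c \<Rightarrow> nat \<Rightarrow> real" where "continuous_on Z e" "inj_on e Z"
proof -
  have "\<forall>\<epsilon>>0. \<exists>k. finite k \<and> k \<subseteq> Z \<and> Z \<subseteq> (\<Union>x\<in>k. ball x \<epsilon>)"
    using seq_compact_imp_totally_bounded[OF compact_imp_seq_compact[OF assms]] by blast
  then have "\<exists>k. finite k \<and> k \<subseteq> Z \<and> Z \<subseteq> (\<Union>x\<in>k. ball x (inverse (real (Suc n))))" for n
    by (meson inverse_positive_iff_positive of_nat_0_less_iff zero_less_Suc)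
  then obtain K where K: "\<And>n. finite (K n)" "\<And>n. Z \<subseteq> (\<Union>x\<in>K n. ball x (inverse (real (Suc n))))"
    by metis
  define D where "D = (\<Union>n. K n)"
  have cD: "countable D" unfolding D_def using K(1) by (simp add: countable_finite)
  define e :: "'c \<Rightarrow> nat \<Rightarrow> real" where "e z = (\<lambda>n. dist z (from_nat_into D n))" for z
  have "continuous_on Z e"
    unfolding e_def
    by (rule continuous_on_coordinatewise_then_product) (intro continuous_intros)
  moreover have "inj_on e Z"
  proof (rule inj_onI, rule ccontr)
    fix x y assume xy: "x \<in> Z" "y \<in> Z" "e x = e y" "x \<noteq> y"
    then have "dist x y / 2 > 0" by simp
    then obtain n where n: "inverse (real (Suc n)) < dist x y / 2"
      using reals_Archimedean by blast
    from K(2)[of n] xy(1) obtain d where d: "d \<in> K n" "dist d x < inverse (real (Suc n))"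
      by (meson UN_E mem_ball subsetD)
    then have "d \<in> D" by (auto simp: D_def)
    then obtain m where "from_nat_into D m = d"
      using from_nat_into_surj[OF cD] by metis
    then have "dist x d = dist y d"
      using fun_cong[OF xy(3), of m] by (simp add: e_def)
    moreover have "dist x y \<le> dist x d + dist y d" by (rule dist_triangle2)
    ultimately show False
      using d(2) n dist_commute[of d x] by linarith
  qed
  ultimately show ?thesis using that by blast
qed

lemma equicontinuous_tds_conjugate:
  fixes Z :: "'c::metric_space set" and W :: "'d::metric_space set"
  assumes R: "equicontinuous_tds Z R"
    and hom: "homeomorphism Z W e e'"
  shows "equicontinuous_tds W (e \<circ> R \<circ> e')"
proof -
  let ?Q = "e \<circ> R \<circ> e'"
  have Z: "compact Z" "continuous_on Z R" "R ` Z \<subseteq> Z"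
    using R by (auto simp: equicontinuous_tds_def tds_def)
  have e: "continuous_on Z e" "e ` Z = W" "\<And>z. z \<in> Z \<Longrightarrow> e' (e z) = z"
    and e': "continuous_on W e'" "e' ` W = Z" "\<And>w. w \<in> W \<Longrightarrow> e (e' w) = w"
    using hom by (auto simp: homeomorphism_def)
  have "compact W" using compact_continuous_image[OF e(1) Z(1)] e(2) by simp
  moreover have "continuous_on W (e \<circ> (R \<circ> e'))"
    by (intro continuous_on_compose e'(1) continuous_on_subset[OF Z(2)] continuous_on_subset[OF e(1)])
       (use Z(3) e'(2) in auto)
  then have "continuous_on W ?Q" by (simp add: comp_assoc)
  moreover have "?Q ` W \<subseteq> W"
  proof (rule image_subsetI)
    fix w assume "w \<in> W"
    then have "R (e' w) \<in> Z" using Z(3) e'(2) by blast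
    then show "?Q w \<in> W" using e(2) by auto
  qed
  ultimately have tW: "tds W ?Q" by (simp add: tds_def)
  have inZ: "(R ^^ n) z \<in> Z" if "z \<in> Z" for n z
    using that Z(3) by (induction n) auto
  have pow: "(?Q ^^ n) w = e ((R ^^ n) (e' w))" if "w \<in> W" for n w
  proof (induction n)
    case 0 then show ?case using e'(3) that by simp
  next
    case (Suc n)
    have "e' w \<in> Z" using e'(2) that by blast
    then show ?case using Suc inZ[of "e' w" n] e(3) by simp
  qed
  have "\<exists>\<delta>>0. \<forall>v\<in>W. dist w v < \<delta> \<longrightarrow> (\<forall>n. dist ((?Q ^^ n) w) ((?Q ^^ n) v) < \<epsilon>)"
    if w: "w \<in> W" and "\<epsilon> > 0" for w and \<epsilon> :: real
  proof -
    have "uniformly_continuous_on Z e" using e(1) Z(1) by (rule compact_uniformly_continuous)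
    then obtain \<eta> where \<eta>: "\<eta> > 0" "\<And>a b. a \<in> Z \<Longrightarrow> b \<in> Z \<Longrightarrow> dist a b < \<eta> \<Longrightarrow> dist (e a) (e b) < \<epsilon>"
      using \<open>\<epsilon> > 0\<close> unfolding uniformly_continuous_on_def by metis
    have ew: "e' w \<in> Z" using w e'(2) by blast
    then obtain \<theta> where \<theta>: "\<theta> > 0"
      "\<And>z n. z \<in> Z \<Longrightarrow> dist (e' w) z < \<theta> \<Longrightarrow> dist ((R ^^ n) (e' w)) ((R ^^ n) z) < \<eta>"
      using R \<eta>(1) unfolding equicontinuous_tds_def by metis
    obtain \<delta> where \<delta>: "\<delta> > 0" "\<And>v. v \<in> W \<Longrightarrow> dist v w < \<delta> \<Longrightarrow> dist (e' v) (e' w) < \<theta>"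
      using e'(1) w \<theta>(1) unfolding continuous_on_iff by metis
    have "dist ((?Q ^^ n) w) ((?Q ^^ n) v) < \<epsilon>" if v: "v \<in> W" "dist w v < \<delta>" for v n
    proof -
      have ev: "e' v \<in> Z" using v e'(2) by blast
      have "dist (e' w) (e' v) < \<theta>" using \<delta>(2)[of v] v by (simp add: dist_commute)
      then show ?thesis using \<eta>(2) \<theta>(2)[OF ev] inZ[OF ev] inZ[OF ew] pow[OF w] pow[OF v(1)] by simp
    qed
    then show ?thesis using \<delta>(1) by blast
  qed
  with tW show ?thesis by (simp add: equicontinuous_tds_def)
qed

lemma maximal_equicontinuous_factorD:
  fixes Z :: "'c::metric_space set"
  assumes max: "maximal_equicontinuous_factor X T Y S f"
    and g: "factor_map X T Z R g" and R: "equicontinuous_tds Z R"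
  shows "\<exists>h. factor_map Y S Z R h"
proof -
  have Z: "compact Z" "tds Z R" "R ` Z \<subseteq> Z" using R by (auto simp: equicontinuous_tds_def tds_def)
  obtain e :: "'c \<Rightarrow> nat \<Rightarrow> real" where "continuous_on Z e" "inj_on e Z"
    using compact_embeds_nat_real[OF Z(1)] by blast
  then obtain e' where hom: "homeomorphism Z (e ` Z) e e'"
    using homeomorphism_compact[OF Z(1)] by blast
  let ?W = "e ` Z" and ?Q = "e \<circ> R \<circ> e'"
  have e: "continuous_on Z e" "\<And>z. z \<in> Z \<Longrightarrow> e' (e z) = z"
    and e': "continuous_on ?W e'" "e' ` ?W = Z"
    using hom by (auto simp: homeomorphism_def)
  have Q: "equicontinuous_tds ?W ?Q" by (rule equicontinuous_tds_conjugate[OF R hom])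
  have gX: "continuous_on X g" "g ` X = Z" "\<And>x. x \<in> X \<Longrightarrow> g (T x) = R (g x)" "tds X T"
    using g by (auto simp: factor_map_def)
  have "continuous_on X (e \<circ> g)" using continuous_on_compose[OF gX(1)] e(1) unfolding gX(2) .
  moreover have "(e \<circ> g) ` X = ?W" by (simp only: image_comp[symmetric] gX(2))
  moreover have "(e \<circ> g) (T x) = ?Q ((e \<circ> g) x)" if "x \<in> X" for x
  proof -
    have "g x \<in> Z" using gX(2) that by blast
    then show ?thesis using gX(3)[OF that] e(2) by simp
  qed
  ultimately have "factor_map X T ?W ?Q (e \<circ> g)"
    using Q gX(4) by (simp add: factor_map_def equicontinuous_tds_def)
  then obtain h where h: "factor_map Y S ?W ?Q h"
    using max Q unfolding maximal_equicontinuous_factor_def by blast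
  then have hY: "continuous_on Y h" "h ` Y = ?W" "\<And>y. y \<in> Y \<Longrightarrow> h (S y) = ?Q (h y)" "tds Y S"
    by (auto simp: factor_map_def)
  have "e' (h (S y)) = R (e' (h y))" if "y \<in> Y" for y
  proof -
    have "e' (h y) \<in> Z" using that hY(2) e'(2) by blast
    then have "R (e' (h y)) \<in> Z" using Z(3) by blast
    then show ?thesis using hY(3)[OF that] e(2) by simp
  qed
  moreover have "(e' \<circ> h) ` Y = Z" by (simp only: image_comp[symmetric] hY(2) e'(2))
  moreover have "continuous_on Y (e' \<circ> h)" using continuous_on_compose[OF hY(1)] e'(1) unfolding hY(2) .
  ultimately have "factor_map Y S Z R (e' \<circ> h)"
    unfolding factor_map_def using hY(4) Z(2) by simp
  then show ?thesis by blast
qed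

end

theory Submission
  imports Defs
begin

text \<open>
  Regularity is measured by the integral of the fibre diameter. This diameter is approximated from
  above by Lipschitz functions \<open>spread L\<close> on the factor, and since ergodic averages of continuous
  functions converge uniformly on a minimal equicontinuous system, the integral of \<open>spread L\<close> is
  computed along any orbit. Small sets \<open>A\<close> satisfy \<open>diam (T\<^sup>i A) \<le> spread L (S\<^sup>i y) + small\<close>, so
  regularity gives Banach diam-mean equicontinuity.

  Conversely, diam-mean equicontinuity makes the upper mean of \<open>dist (T\<^sup>i x) (T\<^sup>i x')\<close> a continuous
  invariant pseudometric, which by maximality vanishes on fibres. A double counting along orbits then
  shows that some fibre is arbitrarily small, hence inside a ball \<open>B\<close> whose images have small mean
  diameter. As \<open>T\<^sup>i B\<close> contains all fibres over a ball of fixed radius about \<open>S\<^sup>i y\<close>, the mean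
  diameter of \<open>T\<^sup>i B\<close> bounds the integral of some \<open>spread L\<close>.
\<close>

section \<open>Averages along orbits\<close>

text \<open>A finite subcover uses finitely many indices, and \<open>m\<close> is their maximum.
  \<open>P\<close> need not be monotone in \<open>n\<close>, hence the conclusion only bounds an
  index. It serves block lengths, hitting times and radii of the form 1/(k+1).\<close>

lemma compact_uniform_index:
  fixes K :: "'a::metric_space set"
  assumes "compact K" and "\<And>x. x \<in> K \<Longrightarrow> \<exists>n::nat. \<exists>e>0. \<forall>y\<in>K. dist x y < e \<longrightarrow> P n y"
  obtains m where "\<And>y. y \<in> K \<Longrightarrow> \<exists>n\<le>m. P n y"
proof -
  obtain n e where ne: "\<And>x. x \<in> K \<Longrightarrow> e x > 0"
    "\<And>x y. x \<in> K \<Longrightarrow> y \<in> K \<Longrightarrow> dist x y < e x \<Longrightarrow> P (n x :: nat) y"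
    using assms(2) by metis
  have "K \<subseteq> (\<Union>x\<in>K. ball x (e x))" using ne(1) by auto
  then obtain C where C: "C \<subseteq> K" "finite C" "K \<subseteq> (\<Union>x\<in>C. ball x (e x))"
    using compactE_image[OF assms(1), of K "\<lambda>x. ball x (e x)"] by auto
  have "\<exists>k\<le>Max (n ` C). P k y" if "y \<in> K" for y
  proof -
    have "y \<in> (\<Union>x\<in>C. ball x (e x))" using C(3) that by blast
    then obtain x where x: "x \<in> C" "dist x y < e x" by auto
    then have "P (n x) y" using ne(2) C(1) that by blast
    moreover have "n x \<le> Max (n ` C)" using x(1) C(2) by simp
    ultimately show ?thesis by blast
  qed
  then show ?thesis using that by blast
qed

lemma funpow_in: "T ` X \<subseteq> X \<Longrightarrow> x \<in> X \<Longrightarrow> (T ^^ n) x \<in> X"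
  by (induction n) auto

lemma continuous_on_funpow:
  assumes "continuous_on X T" "T ` X \<subseteq> X"
  shows "continuous_on X (T ^^ n)"
proof (induction n)
  case (Suc n)
  have "continuous_on ((T ^^ n) ` X) T"
    using assms(1) by (rule continuous_on_subset) (use funpow_in[OF assms(2)] in blast)
  with Suc show ?case unfolding funpow.simps by (rule continuous_on_compose)
qed (simp add: id_def)

lemma sum_funpow_add:
  "(\<Sum>i<n + k. f ((F ^^ i) r)) = (\<Sum>i<n. f ((F ^^ i) r)) + (\<Sum>i<k. (f ((F ^^ i) ((F ^^ n) r)) :: real))"
proof (induction k)
  case (Suc k)
  have "(F ^^ k) ((F ^^ n) r) = (F ^^ (n + k)) r"
    by (simp add: funpow_add add.commute[of n k])
  with Suc show ?case by simp
qed simp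

text \<open>A window starting at time M+1 becomes an initial segment of another orbit, so estimates
  uniform in the starting point turn into estimates uniform in the position of the window.\<close>

lemma sum_shift_funpow:
  "(\<Sum>i=M+1..M+n. f ((F ^^ i) r)) = (\<Sum>i<n. (f ((F ^^ i) ((F ^^ Suc M) r)) :: real))"
proof (induction n)
  case (Suc n)
  have "(F ^^ n) ((F ^^ Suc M) r) = (F ^^ (M + Suc n)) r"
    by (metis (no_types) add.commute add_Suc_right comp_apply funpow_add)
  with Suc show ?case by simp
qed simp

text \<open>Every orbit can be cut into blocks of bounded length on which the average is below \<open>\<eta>\<close>.\<close>

lemma uniform_small_averages:
  fixes K :: "'a::metric_space set" and f :: "'a \<Rightarrow> real"
  assumes "compact K" and F: "continuous_on K F" "F ` K \<subseteq> K"
    and f: "continuous_on K f" "\<And>r. r \<in> K \<Longrightarrow> f r \<ge> 0" and "\<eta> > 0"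
    and small: "\<And>r. r \<in> K \<Longrightarrow> \<exists>n\<ge>1. (\<Sum>i<n. f ((F ^^ i) r)) < \<eta> * real n"
  obtains N0 where "\<And>N r. N \<ge> N0 \<Longrightarrow> r \<in> K \<Longrightarrow> (\<Sum>i<N. f ((F ^^ i) r)) \<le> 2 * \<eta> * real N"
proof -
  let ?A = "\<lambda>n r. \<Sum>i<n. f ((F ^^ i) r)"
  have contA: "continuous_on K (?A n)" for n
  proof (intro continuous_on_sum)
    fix i
    show "continuous_on K (\<lambda>r. f ((F ^^ i) r))"
      by (rule continuous_on_compose2[OF f(1) continuous_on_funpow[OF F]])
        (use funpow_in[OF F(2)] in blast)
  qed
  obtain m where m: "\<And>r. r \<in> K \<Longrightarrow> \<exists>n\<le>m. n \<ge> 1 \<and> ?A n r < \<eta> * real n"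
  proof (rule compact_uniform_index[OF assms(1), of "\<lambda>n r. n \<ge> 1 \<and> ?A n r < \<eta> * real n"])
    fix r assume r: "r \<in> K"
    then obtain n where n: "n \<ge> 1" "?A n r < \<eta> * real n" using small by blast
    then obtain e where e: "e > 0" "\<And>s. s \<in> K \<Longrightarrow> dist s r < e \<Longrightarrow> dist (?A n s) (?A n r) < \<eta> * real n - ?A n r"
      using contA[of n] r unfolding continuous_on_iff by (metis diff_gt_0_iff_gt)
    have "?A n s < \<eta> * real n" if "s \<in> K" "dist r s < e" for s
      using e(2)[of s] that by (simp add: dist_commute dist_real_def)
    then show "\<exists>n. \<exists>e>0. \<forall>y\<in>K. dist r y < e \<longrightarrow> n \<ge> 1 \<and> ?A n y < \<eta> * real n"
      using n(1) e(1) by blast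
  qed blast
  have "bounded (f ` K)" using compact_continuous_image[OF f(1) assms(1)] by (rule compact_imp_bounded)
  then obtain C where C: "C > 0" "\<And>r. r \<in> K \<Longrightarrow> f r \<le> C"
    unfolding bounded_pos by (metis abs_le_D1 image_eqI real_norm_def)
  \<comment> \<open>Peel off a good block while one fits. What remains at the end is shorter than a
    block and contributes at most \<open>m * C\<close>.\<close>
  have bound: "?A N r \<le> \<eta> * real N + real m * C" if "r \<in> K" for N r
    using that
  proof (induction N arbitrary: r rule: less_induct)
    case (less N)
    obtain n where n: "n \<le> m" "n \<ge> 1" "?A n r < \<eta> * real n" using m less.prems by blast
    show ?case
    proof (cases "n \<le> N")
      case True
      have "?A (N - n) ((F ^^ n) r) \<le> \<eta> * real (N - n) + real m * C"
        using True n less.prems funpow_in[OF F(2)] by (intro less.IH) auto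
      then show ?thesis
        using sum_funpow_add[of f F r n "N - n"] n(3) True by (simp add: of_nat_diff algebra_simps)
    next
      case False
      have "?A N r \<le> real (card {..<N}) * C"
        by (rule sum_bounded_above) (use C(2) funpow_in[OF F(2) less.prems] in blast)
      also have "\<dots> \<le> real m * C" using False n(1) C(1) by simp
      finally show ?thesis using \<open>\<eta> > 0\<close> by (simp add: add_increasing)
    qed
  qed
  \<comment> \<open>From \<open>N0\<close> on the remainder \<open>m * C\<close> fits into a second
    copy of \<open>\<eta> * N\<close>.\<close>
  obtain N0 :: nat where N0: "real m * C / \<eta> \<le> real N0" using real_arch_simple by blast
  show ?thesis
  proof (rule that[of N0])
    fix N r assume N: "N0 \<le> N" "r \<in> K"
    then have "real m * C \<le> \<eta> * real N"
    proof -
      have "real m * C / \<eta> \<le> real N" using N0 N(1) by linarith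
      then show ?thesis using \<open>\<eta> > 0\<close> by (simp add: divide_le_eq mult.commute)
    qed
    then show "?A N r \<le> 2 * \<eta> * real N" using bound[OF N(2), of N] by simp
  qed
qed

text \<open>For bounded sequences this is the limsup of the averages of a 1, ..., a N, kept
  real-valued and free of division by N.\<close>

definition upper_mean :: "(nat \<Rightarrow> real) \<Rightarrow> real" where
  "upper_mean a = Inf {c. \<forall>\<^sub>F N in sequentially. (\<Sum>i=1..N. a i) \<le> c * real N}"

text \<open>The two bounds on \<open>a\<close> make the set under \<open>Inf\<close> bounded below
  by 0 and nonempty, as it contains \<open>C\<close>; only then does \<open>Inf\<close> have its
  order-theoretic meaning.\<close>

lemma
  assumes "\<And>i. 0 \<le> a i" "\<And>i. a i \<le> C"
  shows upper_mean_le: "(\<forall>\<^sub>F N in sequentially. (\<Sum>i=1..N. a i) \<le> c * real N) \<Longrightarrow> upper_mean a \<le> c"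
    and upper_mean_nonneg: "0 \<le> upper_mean a"
    and upper_mean_less: "upper_mean a < c \<Longrightarrow> \<forall>\<^sub>F N in sequentially. (\<Sum>i=1..N. a i) \<le> c * real N"
    and upper_mean_bounded: "upper_mean a \<le> C"
proof -
  let ?E = "{c. \<forall>\<^sub>F N in sequentially. (\<Sum>i=1..N. a i) \<le> c * real N}"
  have pos: "c \<ge> 0" if "c \<in> ?E" for c
  proof -
    have "\<forall>\<^sub>F N in sequentially. (\<Sum>i=1..N. a i) \<le> c * real N \<and> N \<ge> 1"
      using that eventually_ge_at_top[of 1] by (simp add: eventually_conj)
    then obtain N where N: "(\<Sum>i=1..N. a i) \<le> c * real N" "N \<ge> 1"
      using eventually_happens'[OF sequentially_bot] by blast
    moreover have "(\<Sum>i=1..N. a i) \<ge> 0" by (intro sum_nonneg assms(1))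
    ultimately show ?thesis 
      by (cases "c < 0") (use mult_neg_pos[of c "real N"] in auto)
  qed
  then have bb: "bdd_below ?E" by (intro bdd_belowI[of _ 0]) auto
  have ne: "C \<in> ?E"
  proof -
    have "(\<Sum>i=1..N. a i) \<le> C * real N" for N
      using sum_bounded_above[of "{1..N}" a C] assms(2) by (simp add: mult.commute)
    then show ?thesis by simp
  qed
  show "(\<forall>\<^sub>F N in sequentially. (\<Sum>i=1..N. a i) \<le> c * real N) \<Longrightarrow> upper_mean a \<le> c"
    unfolding upper_mean_def by (rule cInf_lower[OF _ bb]) simp
  show "upper_mean a \<le> C"
    unfolding upper_mean_def by (rule cInf_lower[OF ne bb])
  show "0 \<le> upper_mean a"
    unfolding upper_mean_def by (rule cInf_greatest) (use ne pos in auto)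
  show "\<forall>\<^sub>F N in sequentially. (\<Sum>i=1..N. a i) \<le> c * real N" if less: "upper_mean a < c"
  proof -
    obtain c' where c': "c' \<in> ?E" "c' < c"
      using cInf_lessD[OF _ less[unfolded upper_mean_def]] ne by blast
    then have "\<forall>\<^sub>F N in sequentially. (\<Sum>i=1..N. a i) \<le> c' * real N" by simp
    then show ?thesis
    proof eventually_elim
      case (elim N)
      have "c' * real N \<le> c * real N" using c'(2) by (intro mult_right_mono) auto
      with elim show ?case by linarith
    qed
  qed
qed

lemma upper_mean_add:
  assumes "\<And>i. 0 \<le> a i" "\<And>i. a i \<le> C" "\<And>i. 0 \<le> b i" "\<And>i. b i \<le> C"
    "\<And>i. 0 \<le> c i" "\<And>i. c i \<le> C" and le: "\<And>i. c i \<le> a i + b i"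
  shows "upper_mean c \<le> upper_mean a + upper_mean b"
proof (rule field_le_epsilon)
  fix e :: real assume "e > 0"
  have "\<forall>\<^sub>F N in sequentially. (\<Sum>i=1..N. a i) \<le> (upper_mean a + e/2) * real N"
    "\<forall>\<^sub>F N in sequentially. (\<Sum>i=1..N. b i) \<le> (upper_mean b + e/2) * real N"
    using \<open>e > 0\<close>
    by (intro upper_mean_less[of a C] upper_mean_less[of b C] assms(1-4); simp)+
  then have "\<forall>\<^sub>F N in sequentially. (\<Sum>i=1..N. c i) \<le> (upper_mean a + upper_mean b + e) * real N"
  proof eventually_elim
    case (elim N)
    have "(\<Sum>i=1..N. c i) \<le> (\<Sum>i=1..N. a i) + (\<Sum>i=1..N. b i)"
      unfolding sum.distrib[symmetric] by (intro sum_mono le)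
    with elim show ?case by (simp add: algebra_simps)
  qed
  then show "upper_mean c \<le> upper_mean a + upper_mean b + e"
    by (rule upper_mean_le[OF assms(5,6)])
qed

text \<open>The two partial sums differ by a (N+1) - a 1, which is at most \<open>C\<close> in
  absolute value and hence negligible against N.\<close>

lemma upper_mean_shift:
  assumes a: "\<And>i. 0 \<le> a i" "\<And>i. a i \<le> C"
  shows "upper_mean (\<lambda>i. a (Suc i)) = upper_mean a"
proof (rule antisym; rule field_le_epsilon)
  fix e :: real assume "e > 0"
  have C: "0 \<le> C" using a[of 0] by simp
  obtain n0 :: nat where "2 * C / e \<le> real n0" using real_arch_simple by blast
  then have n0: "2 * C \<le> e * real N" if "N \<ge> n0" for N
  proof -
    have "2 * C / e \<le> real N" using \<open>2 * C / e \<le> real n0\<close> that by linarith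
    then show ?thesis using \<open>e > 0\<close> by (simp add: divide_le_eq mult.commute)
  qed
  have shift: "(\<Sum>i=1..N. a (Suc i)) = (\<Sum>i=1..N. a i) + a (Suc N) - a 1" for N
    by (induction N) auto
  have "\<forall>\<^sub>F N in sequentially. (\<Sum>i=1..N. a i) \<le> (upper_mean a + e/2) * real N"
    using \<open>e > 0\<close> by (intro upper_mean_less[of _ C] a) auto
  then have "\<forall>\<^sub>F N in sequentially. (\<Sum>i=1..N. a (Suc i)) \<le> (upper_mean a + e) * real N"
    using eventually_ge_at_top[of n0]
  proof eventually_elim
    case (elim N)
    then show ?case using shift[of N] n0[of N] a(1)[of 1] a(2)[of "Suc N"] by (simp add: algebra_simps)
  qed
  then show "upper_mean (\<lambda>i. a (Suc i)) \<le> upper_mean a + e" 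
    by (rule upper_mean_le[of "\<lambda>i. a (Suc i)", OF a])
  have "\<forall>\<^sub>F N in sequentially. (\<Sum>i=1..N. a (Suc i)) \<le> (upper_mean (\<lambda>i. a (Suc i)) + e/2) * real N"
    using \<open>e > 0\<close> by (intro upper_mean_less[of _ C] a) auto
  then have "\<forall>\<^sub>F N in sequentially. (\<Sum>i=1..N. a i) \<le> (upper_mean (\<lambda>i. a (Suc i)) + e) * real N"
    using eventually_ge_at_top[of n0]
  proof eventually_elim
    case (elim N)
    then show ?case using shift[of N] n0[of N] a(2)[of 1] a(1)[of "Suc N"] by (simp add: algebra_simps)
  qed
  then show "upper_mean a \<le> upper_mean (\<lambda>i. a (Suc i)) + e"
    by (rule upper_mean_le[OF a])
qed

section \<open>Minimal and equicontinuous systems\<close>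

text \<open>The empty system is vacuously minimal, so nonemptiness is a separate assumption. The
  final theorem obtains it from the invariant probability measure.\<close>

locale minimal_system =
  fixes X :: "'a::metric_space set" and T :: "'a \<Rightarrow> 'a"
  assumes minimal: "minimal_tds X T" and nonempty: "X \<noteq> {}"
begin

lemma tds: "tds X T" and compact: "compact X" and cont: "continuous_on X T" and maps: "T ` X \<subseteq> X"
  using minimal by (auto simp: minimal_tds_def tds_def)

lemmas pow_in = funpow_in[OF maps]
lemmas cont_pow = continuous_on_funpow[OF cont maps]

text \<open>Minimality is applied to the orbit of \<open>(T ^^ k) x\<close>, so the visiting time
  can be taken as late as desired.\<close>

lemma orbit_dense:
  assumes "x \<in> X" "y \<in> X" "e > 0"
  obtains n where "n \<ge> k" "dist ((T ^^ n) x) y < e"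
proof -
  have "y \<in> closure (range (\<lambda>n. (T ^^ n) ((T ^^ k) x)))"
    using minimal pow_in[OF assms(1)] assms(2) unfolding minimal_tds_def by blast
  then obtain n where "dist ((T ^^ n) ((T ^^ k) x)) y < e"
    using assms(3) unfolding closure_approachable by blast
  then show ?thesis using that[of "n + k"] by (simp add: funpow_add)
qed

text \<open>The image of \<open>T\<close> is compact, hence closed, and contains the dense orbit of
  \<open>T x\<close>.\<close>

lemma surj_pow: "(T ^^ n) ` X = X"
proof (induction n)
  case (Suc n)
  have "T ` X = X"
  proof
    obtain x where x: "x \<in> X" using nonempty by blast
    have "range (\<lambda>n. (T ^^ n) (T x)) \<subseteq> T ` X"
      using pow_in[OF x] by (auto simp: funpow_swap1[symmetric])
    moreover have "closed (T ` X)"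
      by (rule compact_imp_closed[OF compact_continuous_image[OF cont compact]])
    ultimately have "closure (range (\<lambda>n. (T ^^ n) (T x))) \<subseteq> T ` X" by (rule closure_minimal)
    then show "X \<subseteq> T ` X" using minimal maps x unfolding minimal_tds_def by blast
  qed (rule maps)
  with Suc show ?case by (simp only: funpow.simps image_comp[symmetric])
qed simp

text \<open>A visiting time of y also works near y by continuity of the iterate, and compactness
  bounds these times.\<close>

lemma hitting_time:
  assumes z: "z \<in> X" and "e > 0"
  obtains m where "\<And>y. y \<in> X \<Longrightarrow> \<exists>j\<le>m. dist ((T ^^ j) y) z < e"
proof (rule compact_uniform_index[OF compact, of "\<lambda>j y. dist ((T ^^ j) y) z < e"])
  fix y assume y: "y \<in> X"
  then obtain j where j: "dist ((T ^^ j) y) z < e" using orbit_dense[OF y z \<open>e > 0\<close>] by metis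
  then obtain d where d: "d > 0" "\<And>u. u \<in> X \<Longrightarrow> dist u y < d \<Longrightarrow>
      dist ((T ^^ j) u) ((T ^^ j) y) < e - dist ((T ^^ j) y) z"
    using cont_pow[of j] y unfolding continuous_on_iff by (metis diff_gt_0_iff_gt)
  have "dist ((T ^^ j) u) z < e" if "u \<in> X" "dist y u < d" for u
    using d(2)[of u] that dist_triangle[of "(T ^^ j) u" z "(T ^^ j) y"] by (simp add: dist_commute)
  then show "\<exists>n. \<exists>d>0. \<forall>u\<in>X. dist y u < d \<longrightarrow> dist ((T ^^ n) u) z < e"
    using d(1) by blast
qed (use that in blast)

end

section \<open>Endomorphisms and ergodic averages of minimal equicontinuous systems\<close>

locale equicontinuous_minimal_system = minimal_system +
  assumes equicontinuous: "equicontinuous_tds X T"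
begin

text \<open>Around each x two nearby points are compared through x itself; compactness then makes
  the radius 1/(k+1) independent of x.\<close>

lemma uniform_equicontinuity:
  assumes "e > 0"
  obtains d where "d > 0"
    "\<And>x y n. x \<in> X \<Longrightarrow> y \<in> X \<Longrightarrow> dist x y < d \<Longrightarrow> dist ((T ^^ n) x) ((T ^^ n) y) < e"
proof -
  let ?P = "\<lambda>k x. \<forall>y\<in>X. dist x y < inverse (real (Suc k)) \<longrightarrow> (\<forall>n. dist ((T ^^ n) x) ((T ^^ n) y) < e)"
  obtain m where m: "\<And>x. x \<in> X \<Longrightarrow> \<exists>k\<le>m. ?P k x"
  proof (rule compact_uniform_index[OF compact, of ?P])
    fix x assume x: "x \<in> X"
    obtain d where d: "d > 0" "\<And>y n. y \<in> X \<Longrightarrow> dist x y < d \<Longrightarrow> dist ((T ^^ n) x) ((T ^^ n) y) < e / 2"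
      using equicontinuous x assms unfolding equicontinuous_tds_def by (metis half_gt_zero)
    obtain k where k: "inverse (real (Suc k)) < d / 2" using reals_Archimedean[of "d / 2"] d(1) by auto
    have "dist ((T ^^ n) y) ((T ^^ n) z) < e"
      if "y \<in> X" "z \<in> X" "dist x y < d / 2" "dist y z < inverse (real (Suc k))" for y z n
    proof -
      have "dist x z < d" using that k dist_triangle[of x z y] by linarith
      then show ?thesis
        using d(2)[of y n] d(2)[of z n] that d(1) dist_triangle3[of "(T ^^ n) y" "(T ^^ n) z" "(T ^^ n) x"]
        by simp
    qed
    then show "\<exists>k. \<exists>e'>0. \<forall>y\<in>X. dist x y < e' \<longrightarrow> ?P k y"
      using d(1) by (intro exI[of _ k] exI[of _ "d / 2"]) auto
  qed blast
  show ?thesis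
  proof (rule that[of "inverse (real (Suc m))"])
    fix x y n assume xy: "x \<in> X" "y \<in> X" "dist x y < inverse (real (Suc m))"
    obtain k where k: "k \<le> m" "?P k x" using m xy(1) by blast
    have "inverse (real (Suc m)) \<le> inverse (real (Suc k))"
      using k(1) by (intro le_imp_inverse_le) auto
    then have "dist x y < inverse (real (Suc k))" using xy(3) by linarith
    then show "dist ((T ^^ n) x) ((T ^^ n) y) < e" using k(2) xy(2) by blast
  qed simp
qed

text \<open>Choose n so that \<open>(T ^^ n) x\<close> is close to \<open>\<phi> x\<close> at a
  single x. As both maps commute with \<open>T\<close>, equicontinuity carries the closeness along
  the orbit of x, and density carries it to all of \<open>X\<close>.\<close>

lemma endomorphism_approx:
  assumes \<phi>: "continuous_on X \<phi>" "\<phi> ` X \<subseteq> X" "\<And>x. x \<in> X \<Longrightarrow> \<phi> (T x) = T (\<phi> x)" and "e > 0"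
  obtains n where "n \<ge> k" "\<And>y. y \<in> X \<Longrightarrow> dist (\<phi> y) ((T ^^ n) y) < e"
proof -
  obtain d where d: "d > 0"
    "\<And>x y n. x \<in> X \<Longrightarrow> y \<in> X \<Longrightarrow> dist x y < d \<Longrightarrow> dist ((T ^^ n) x) ((T ^^ n) y) < e / 3"
    using uniform_equicontinuity[of "e / 3"] \<open>e > 0\<close> by auto
  obtain x where x: "x \<in> X" using nonempty by blast
  have \<phi>x: "\<phi> x \<in> X" using \<phi>(2) x by blast
  obtain n where n: "n \<ge> k" "dist ((T ^^ n) x) (\<phi> x) < d" using orbit_dense[OF x \<phi>x d(1)] by metis
  have comm: "\<phi> ((T ^^ j) x) = (T ^^ j) (\<phi> x)" for j
    using pow_in[OF x] \<phi>(3) by (induction j) auto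
  have "dist (\<phi> y) ((T ^^ n) y) < e" if y: "y \<in> X" for y
  proof -
    obtain d' where d': "d' > 0" "\<And>z. z \<in> X \<Longrightarrow> dist z y < d' \<Longrightarrow> dist (\<phi> z) (\<phi> y) < e / 3"
      using \<phi>(1) y \<open>e > 0\<close> unfolding continuous_on_iff by (metis zero_less_divide_iff zero_less_numeral)
    obtain j where "dist ((T ^^ j) x) y < min d d'" 
      using orbit_dense[OF x y, of "min d d'"] d(1) d'(1) by (metis min_less_iff_conj)
    then have j: "dist ((T ^^ j) x) y < d" "dist ((T ^^ j) x) y < d'" by auto
    have "dist (\<phi> ((T ^^ j) x)) (\<phi> y) < e / 3" by (rule d'(2)[OF pow_in[OF x] j(2)])
    moreover have "dist ((T ^^ j) (\<phi> x)) ((T ^^ j) ((T ^^ n) x)) < e / 3"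
      using d(2)[OF \<phi>x pow_in[OF x]] n(2) by (simp add: dist_commute)
    moreover have "dist ((T ^^ n) ((T ^^ j) x)) ((T ^^ n) y) < e / 3"
      using d(2)[OF pow_in[OF x] y] j(1) by simp
    moreover have "(T ^^ n) ((T ^^ j) x) = (T ^^ j) ((T ^^ n) x)"
      by (metis add.commute comp_apply funpow_add)
    ultimately show ?thesis
      using comm[of j] dist_triangle3[of "\<phi> y" "(T ^^ n) y" "\<phi> ((T ^^ j) x)"]
        dist_triangle[of "\<phi> ((T ^^ j) x)" "(T ^^ n) y" "(T ^^ j) ((T ^^ n) x)"] by simp
  qed
  then show ?thesis using that n(1) by blast
qed

text \<open>Approximating the identity gives an m \<ge> n for which \<open>T ^^ m\<close> moves
  every point little. If the n-th images are close, so are the m-th images by equicontinuity, and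
  hence the points themselves.\<close>

lemma inverse_equicontinuity:
  assumes "e > 0"
  obtains d where "d > 0"
    "\<And>x y n. x \<in> X \<Longrightarrow> y \<in> X \<Longrightarrow> dist ((T ^^ n) x) ((T ^^ n) y) < d \<Longrightarrow> dist x y < e"
proof -
  obtain d where d: "d > 0"
    "\<And>x y n. x \<in> X \<Longrightarrow> y \<in> X \<Longrightarrow> dist x y < d \<Longrightarrow> dist ((T ^^ n) x) ((T ^^ n) y) < e / 3"
    using uniform_equicontinuity[of "e / 3"] assms by auto
  have "dist x y < e" if xy: "x \<in> X" "y \<in> X" "dist ((T ^^ n) x) ((T ^^ n) y) < d" for x y n
  proof -
    obtain m where m: "m \<ge> n" "\<And>y. y \<in> X \<Longrightarrow> dist y ((T ^^ m) y) < e / 3"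
      using endomorphism_approx[of "\<lambda>x. x" "e / 3" n] assms by (auto simp: continuous_on_id)
    have "(T ^^ (m - n)) ((T ^^ n) z) = (T ^^ m) z" for z
      using m(1) by (metis comp_apply funpow_add le_add_diff_inverse2)
    then have "dist ((T ^^ m) x) ((T ^^ m) y) < e / 3"
      using d(2)[OF pow_in[OF xy(1)] pow_in[OF xy(2)] xy(3), of "m - n"] by simp
    then show ?thesis
      using m(2)[OF xy(1)] m(2)[OF xy(2)] dist_triangle[of x y "(T ^^ m) x"]
        dist_triangle2[of "(T ^^ m) x" y "(T ^^ m) y"] by simp
  qed
  then show ?thesis using that d(1) by blast
qed

lemma inj_pow: "inj_on (T ^^ n) X"
proof (rule inj_onI, rule ccontr)
  fix x y assume xy: "x \<in> X" "y \<in> X" "(T ^^ n) x = (T ^^ n) y" "x \<noteq> y"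
  obtain d where "d > 0" "\<And>a b n. a \<in> X \<Longrightarrow> b \<in> X \<Longrightarrow> dist ((T ^^ n) a) ((T ^^ n) b) < d \<Longrightarrow> dist a b < dist x y"
    using inverse_equicontinuity[of "dist x y"] xy(4) by auto
  then show False using xy by (metis dist_self less_irrefl)
qed

text \<open>\<open>\<phi>\<close> is uniformly close to some iterate of \<open>T\<close>, and
  iterates separate points at a scale that does not depend on the exponent.\<close>

lemma endomorphism_inj:
  assumes \<phi>: "continuous_on X \<phi>" "\<phi> ` X \<subseteq> X" "\<And>x. x \<in> X \<Longrightarrow> \<phi> (T x) = T (\<phi> x)"
  shows "inj_on \<phi> X"
proof (rule inj_onI, rule ccontr)
  fix x y assume xy: "x \<in> X" "y \<in> X" "\<phi> x = \<phi> y" "x \<noteq> y"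
  obtain d where d: "d > 0"
    "\<And>a b n. a \<in> X \<Longrightarrow> b \<in> X \<Longrightarrow> dist ((T ^^ n) a) ((T ^^ n) b) < d \<Longrightarrow> dist a b < dist x y"
    using inverse_equicontinuity[of "dist x y"] xy(4) by auto
  obtain n where n: "\<And>y. y \<in> X \<Longrightarrow> dist (\<phi> y) ((T ^^ n) y) < d / 2"
    using endomorphism_approx[OF \<phi>, of "d / 2" 0] d(1) by (metis half_gt_zero)
  have "dist ((T ^^ n) x) ((T ^^ n) y) < d"
    using n[OF xy(1)] n[OF xy(2)] xy(3) dist_triangle3[of "(T ^^ n) x" "(T ^^ n) y" "\<phi> x"] by simp
  then show False using d(2)[OF xy(1,2)] by blast
qed

text \<open>Birkhoff sums hardly depend on the starting point, because every orbit soon shadows that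
  of a fixed z. Their integral is n times that of \<open>\<phi>\<close> by invariance, so the sums
  are close to that value everywhere.\<close>

lemma averages_converge_uniformly:
  fixes \<phi> :: "'a \<Rightarrow> real"
  assumes \<nu>: "invariant_borel_prob X T \<nu>" and \<phi>: "continuous_on X \<phi>" and "e > 0"
  obtains n0 where "\<And>n y. n \<ge> n0 \<Longrightarrow> y \<in> X \<Longrightarrow>
    \<bar>(\<Sum>i<n. \<phi> ((T ^^ i) y)) - real n * (\<integral>x. \<phi> x \<partial>\<nu>)\<bar> \<le> e * real n"
proof -
  let ?A = "\<lambda>n y. \<Sum>i<n. \<phi> ((T ^^ i) y)"
  have "bounded (\<phi> ` X)" using compact_continuous_image[OF \<phi> compact] by (rule compact_imp_bounded)
  then obtain C where "C > 0" and C: "\<And>y. y \<in> X \<Longrightarrow> \<bar>\<phi> y\<bar> \<le> C"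
    unfolding bounded_pos by auto
  obtain z where z: "z \<in> X" using nonempty by blast
  have "uniformly_continuous_on X \<phi>" using \<phi> compact by (rule compact_uniformly_continuous)
  then obtain d1 where d1: "d1 > 0" "\<And>a b. a \<in> X \<Longrightarrow> b \<in> X \<Longrightarrow> dist a b < d1 \<Longrightarrow> dist (\<phi> a) (\<phi> b) < e / 4"
    using \<open>e > 0\<close> unfolding uniformly_continuous_on_def by (metis zero_less_divide_iff zero_less_numeral)
  obtain d2 where d2: "d2 > 0"
    "\<And>x y n. x \<in> X \<Longrightarrow> y \<in> X \<Longrightarrow> dist x y < d2 \<Longrightarrow> dist ((T ^^ n) x) ((T ^^ n) y) < d1"
    using uniform_equicontinuity[OF d1(1)] by metis
  obtain m where m: "\<And>y. y \<in> X \<Longrightarrow> \<exists>j\<le>m. dist ((T ^^ j) y) z < d2"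
    using hitting_time[OF z d2(1)] by metis
  \<comment> \<open>After at most \<open>m\<close> steps the orbit of y is within \<open>d2\<close>
    of z, and from then on \<open>\<phi>\<close> differs by at most e/4 along the two orbits.
    Shifting the window by j changes the sum by at most \<open>2 * C * m\<close>.\<close>
  have osc: "\<bar>?A n y - ?A n z\<bar> \<le> e / 4 * real n + 2 * C * real m" if y: "y \<in> X" for n y
  proof -
    obtain j where j: "j \<le> m" "dist ((T ^^ j) y) z < d2" using m y by blast
    have "\<bar>\<phi> ((T ^^ i) ((T ^^ j) y)) - \<phi> ((T ^^ i) z)\<bar> \<le> e / 4" for i
      using d1(2)[OF pow_in[OF pow_in[OF y]] pow_in[OF z] d2(2)[OF pow_in[OF y] z j(2)], of i]
      by (simp add: dist_real_def)
    then have "\<bar>\<Sum>i<n. \<phi> ((T ^^ i) ((T ^^ j) y)) - \<phi> ((T ^^ i) z)\<bar> \<le> real (card {..<n}) * (e / 4)"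
      by (intro order_trans[OF sum_abs] sum_bounded_above)
    then have 1: "\<bar>?A n ((T ^^ j) y) - ?A n z\<bar> \<le> e / 4 * real n"
      by (simp add: sum_subtractf mult.commute)
    have short: "\<bar>?A j w\<bar> \<le> C * real m" if "w \<in> X" for w
    proof -
      have "\<bar>?A j w\<bar> \<le> real (card {..<j}) * C"
        by (intro order_trans[OF sum_abs] sum_bounded_above C pow_in that)
      also have "\<dots> \<le> real m * C" using j(1) \<open>C > 0\<close> by simp
      finally show ?thesis by (simp add: mult.commute)
    qed
    \<comment> \<open>Both sides are the sum over the first n + j iterates of y.\<close>
    have "?A j y + ?A n ((T ^^ j) y) = ?A n y + ?A j ((T ^^ n) y)"
      using sum_funpow_add[of \<phi> T y j n] sum_funpow_add[of \<phi> T y n j] by (simp add: add.commute)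
    then show ?thesis using 1 short[OF y] short[OF pow_in[OF y, of n]] by linarith
  qed
  interpret prob_space \<nu> using \<nu> by (simp add: invariant_borel_prob_def)
  have sets: "sets \<nu> = sets (restrict_space borel X)" and inv: "distr \<nu> \<nu> T = \<nu>"
    using \<nu> by (auto simp: invariant_borel_prob_def)
  have space: "space \<nu> = X" using sets_eq_imp_space_eq[OF sets] by (simp add: space_restrict_space)
  have meas: "f \<in> borel_measurable \<nu>" if "continuous_on X f" for f :: "'a \<Rightarrow> real"
    using borel_measurable_continuous_on_restrict[OF that] measurable_cong_sets[OF sets refl] by blast
  have T: "T \<in> measurable \<nu> \<nu>"
    unfolding measurable_cong_sets[OF sets sets]
    by (rule measurable_restrict_space2)
      (use maps in \<open>auto simp: space_restrict_space intro!: borel_measurable_continuous_on_restrict cont\<close>)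
  have cont_i: "continuous_on X (\<lambda>y. \<phi> ((T ^^ i) y))" for i
    by (rule continuous_on_compose2[OF \<phi> cont_pow]) (use pow_in in blast)
  have int: "integrable \<nu> (\<lambda>y. \<phi> ((T ^^ i) y))" for i
    by (rule integrable_const_bound[of _ C]) (auto simp: space intro!: C pow_in meas cont_i)
  have step: "(\<integral>y. \<phi> ((T ^^ i) y) \<partial>\<nu>) = (\<integral>y. \<phi> y \<partial>\<nu>)" for i
  proof (induction i)
    case (Suc i)
    have "(\<integral>y. \<phi> ((T ^^ i) y) \<partial>\<nu>) = (\<integral>y. \<phi> ((T ^^ i) y) \<partial>distr \<nu> \<nu> T)" by (simp add: inv)
    also have "\<dots> = (\<integral>y. \<phi> ((T ^^ i) (T y)) \<partial>\<nu>)" by (rule integral_distr[OF T meas[OF cont_i]])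
    finally show ?case using Suc by (simp add: funpow_swap1)
  qed simp
  have mean: "(\<integral>y. ?A n y \<partial>\<nu>) = real n * (\<integral>y. \<phi> y \<partial>\<nu>)" for n
    by (subst Bochner_Integration.integral_sum) (simp_all add: int step)
  have near: "\<bar>real n * (\<integral>y. \<phi> y \<partial>\<nu>) - ?A n z\<bar> \<le> e / 4 * real n + 2 * C * real m" for n
  proof -
    let ?b = "e / 4 * real n + 2 * C * real m"
    have intA: "integrable \<nu> (?A n)" by (intro Bochner_Integration.integrable_sum int)
    have "?A n z - ?b \<le> ?A n y \<and> ?A n y \<le> ?A n z + ?b" if "y \<in> X" for y
      using osc[OF that, of n] by linarith
    then have "(\<integral>y. ?A n y \<partial>\<nu>) \<le> ?A n z + ?b" "(\<integral>y. ?A n y \<partial>\<nu>) \<ge> ?A n z - ?b"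
      by (auto intro!: integral_le_const integral_ge_const intA simp: space)
    then show ?thesis using mean[of n] by (simp add: abs_le_iff)
  qed
  \<comment> \<open>The oscillation bound enters twice, from y to z and from z to the integral, for
    a total of \<open>e / 2 * n + 4 * C * m\<close>.\<close>
  obtain n0 :: nat where n0: "4 * C * real m / (e / 2) \<le> real n0" using real_arch_simple by blast
  show ?thesis
  proof (rule that[of n0])
    fix n y assume n: "n0 \<le> n" and y: "y \<in> X"
    have "4 * C * real m / (e / 2) \<le> real n" using n0 n by linarith
    then have "4 * C * real m \<le> e / 2 * real n" using \<open>e > 0\<close> by (simp add: field_simps)
    then show "\<bar>?A n y - real n * (\<integral>x. \<phi> x \<partial>\<nu>)\<bar> \<le> e * real n"
      using osc[OF y, of n] near[of n] by linarith
  qed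
qed

end

section \<open>Fibres of an equicontinuous factor\<close>

lemma diameter_least:
  fixes A :: "'a::metric_space set"
  assumes "0 \<le> d" "\<And>x y. x \<in> A \<Longrightarrow> y \<in> A \<Longrightarrow> dist x y \<le> d"
  shows "diameter A \<le> d"
  using assms by (auto simp: diameter_def intro!: cSUP_least)

text \<open>Identifying points at \<open>D\<close>-distance 0 gives a metric quotient on which
  \<open>T\<close> acts isometrically, hence equicontinuously. The quotient is realised inside a
  fixed metric type of bounded sequences.\<close>

lemma (in minimal_system) invariant_pseudometric_factor:
  fixes D :: "'a \<Rightarrow> 'a \<Rightarrow> real"
  assumes refl: "\<And>x. x \<in> X \<Longrightarrow> D x x = 0" and sym: "\<And>x y. x \<in> X \<Longrightarrow> y \<in> X \<Longrightarrow> D x y = D y x"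
    and nonneg: "\<And>x y. x \<in> X \<Longrightarrow> y \<in> X \<Longrightarrow> 0 \<le> D x y"
    and bounded: "\<And>x y. x \<in> X \<Longrightarrow> y \<in> X \<Longrightarrow> D x y \<le> C"
    and triangle: "\<And>x y z. x \<in> X \<Longrightarrow> y \<in> X \<Longrightarrow> z \<in> X \<Longrightarrow> D x z \<le> D x y + D y z"
    and invariant: "\<And>x y. x \<in> X \<Longrightarrow> y \<in> X \<Longrightarrow> D (T x) (T y) = D x y"
    and cont_D: "\<And>x e. x \<in> X \<Longrightarrow> e > 0 \<Longrightarrow> \<exists>d>0. \<forall>y\<in>X. dist x y < d \<longrightarrow> D x y < e"
  obtains Z :: "(nat \<Rightarrow>\<^sub>C real) set" and R g where "factor_map X T Z R g" "equicontinuous_tds Z R"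
    "\<And>x y. x \<in> X \<Longrightarrow> y \<in> X \<Longrightarrow> dist (g x) (g y) = D x y"
proof -
  obtain x0 where x0: "x0 \<in> X" using nonempty by blast
  define p where "p n = (T ^^ n) x0" for n
  have p: "p n \<in> X" for n unfolding p_def by (rule pow_in[OF x0])
  text \<open>The Kuratowski embedding of the quotient, tested only on the dense orbit of \<open>x0\<close>.\<close>
  define g :: "'a \<Rightarrow> nat \<Rightarrow>\<^sub>C real" where "g x = Bcontfun (\<lambda>n. D x (p n))" for x
  have g: "apply_bcontfun (g x) n = D x (p n)" if "x \<in> X" for x n
  proof -
    have "(\<lambda>n. D x (p n)) \<in> bcontfun"
      by (rule bcontfun_normI[of _ C])
        (use nonneg[OF that p] bounded[OF that p] in \<open>auto simp: continuous_on_discrete\<close>)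
    then show ?thesis by (simp add: g_def Bcontfun_inverse)
  qed
  have dist_g: "dist (g x) (g y) = D x y" if xy: "x \<in> X" "y \<in> X" for x y
  proof (rule antisym)
    show "dist (g x) (g y) \<le> D x y"
    proof (rule dist_bound)
      fix n
      have "D x (p n) \<le> D x y + D y (p n)" "D y (p n) \<le> D x y + D x (p n)"
        using triangle[OF xy p] triangle[OF xy(2,1) p] sym[OF xy] by auto
      then show "dist (apply_bcontfun (g x) n) (apply_bcontfun (g y) n) \<le> D x y"
        by (simp add: g xy dist_real_def abs_le_iff)
    qed
    show "D x y \<le> dist (g x) (g y)"
    \<comment> \<open>For an orbit point \<open>p n\<close> that is \<open>D\<close>-close to y, the
      coordinate n alone nearly attains \<open>D x y\<close>.\<close>
    proof (rule field_le_epsilon)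
      fix e :: real assume "e > 0"
      obtain d where d: "d > 0" "\<And>z. z \<in> X \<Longrightarrow> dist y z < d \<Longrightarrow> D y z < e / 2"
        using cont_D[OF xy(2), of "e / 2"] \<open>e > 0\<close> by auto
      obtain n where "dist (p n) y < d" using orbit_dense[OF x0 xy(2) d(1)] unfolding p_def by metis
      then have n: "D y (p n) < e / 2" using d(2)[OF p] by (simp add: dist_commute)
      have "\<bar>D x (p n) - D y (p n)\<bar> \<le> dist (g x) (g y)"
        using dist_bounded[of "g x" n "g y"] by (simp add: g xy dist_real_def)
      moreover have "D x y \<le> D x (p n) + D y (p n)"
        using triangle[OF xy(1) p xy(2)] sym[OF xy(2) p] by simp
      ultimately show "D x y \<le> dist (g x) (g y) + e" using n by linarith
    qed
  qed
  \<comment> \<open>The chosen preimage does not matter: two preimages of the same point have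
    \<open>D\<close>-distance 0, and so do their images under \<open>T\<close>.\<close>
  define R where "R z = g (T (SOME x. x \<in> X \<and> g x = z))" for z
  have R: "R (g x) = g (T x)" if "x \<in> X" for x
  proof -
    let ?s = "SOME x'. x' \<in> X \<and> g x' = g x"
    have s: "?s \<in> X \<and> g ?s = g x" by (rule someI[of _ x]) (use that in simp)
    moreover have "T ?s \<in> X" "T x \<in> X" using s that maps by auto
    ultimately have "dist (g (T ?s)) (g (T x)) = D ?s x"
      using that by (simp only: dist_g invariant)
    also have "\<dots> = 0" using dist_g[of ?s x] s that by simp
    finally show ?thesis by (simp add: R_def)
  qed
  have contg: "continuous_on X g"
    unfolding continuous_on_iff
  proof (intro ballI allI impI)
    fix x e assume x: "x \<in> X" and "(e::real) > 0"
    then obtain d where "d > 0" "\<And>y. y \<in> X \<Longrightarrow> dist x y < d \<Longrightarrow> D x y < e" using cont_D by blast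
    then show "\<exists>d>0. \<forall>y\<in>X. dist y x < d \<longrightarrow> dist (g y) (g x) < e"
      using x by (intro exI[of _ d]) (auto simp: dist_g sym[OF _ x] dist_commute)
  qed
  have iso: "dist (R a) (R b) = dist a b" if ab: "a \<in> g ` X" "b \<in> g ` X" for a b
  proof -
    obtain x y where xy: "x \<in> X" "y \<in> X" "a = g x" "b = g y" using ab by blast
    have "T x \<in> X" "T y \<in> X" using maps xy by auto
    then show ?thesis using xy by (simp add: R dist_g invariant)
  qed
  have RZ: "R ` (g ` X) \<subseteq> g ` X" using R maps by force
  have tds_R: "tds (g ` X) R"
    unfolding tds_def
    using compact_continuous_image[OF contg compact] RZ iso by (auto simp: continuous_on_iff)
  have "dist ((R ^^ n) a) ((R ^^ n) b) = dist a b" if "a \<in> g ` X" "b \<in> g ` X" for a b n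
    using that funpow_in[OF RZ] iso by (induction n) auto
  then have "equicontinuous_tds (g ` X) R"
    using tds_R by (auto simp: equicontinuous_tds_def)
  moreover have "factor_map X T (g ` X) R g"
    using tds_R contg R tds by (simp add: factor_map_def)
  ultimately show ?thesis using that dist_g by blast
qed

lemma factor_minimal_tds:
  assumes "minimal_tds X T" and f: "factor_map X T Y S f"
  shows "minimal_tds Y S"
proof -
  have f': "continuous_on X f" "f ` X = Y" "\<And>x. x \<in> X \<Longrightarrow> f (T x) = S (f x)" and "tds X T" "tds Y S"
    using f by (auto simp: factor_map_def)
  then have maps: "T ` X \<subseteq> X" by (simp add: tds_def)
  have comm: "f ((T ^^ n) x) = (S ^^ n) (f x)" if "x \<in> X" for x n
    using funpow_in[OF maps that] f'(3) by (induction n) auto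
  have "y \<in> closure (range (\<lambda>n. (S ^^ n) z))" if zy: "z \<in> Y" "y \<in> Y" for y z
  proof -
    obtain x u where x: "x \<in> X" "z = f x" and u: "u \<in> X" "y = f u" using zy f'(2) by blast
    show ?thesis
      unfolding closure_approachable
    proof (intro allI impI)
      fix e :: real assume "e > 0"
      then obtain d where d: "d > 0" "\<And>v. v \<in> X \<Longrightarrow> dist v u < d \<Longrightarrow> dist (f v) (f u) < e"
        using f'(1) u(1) unfolding continuous_on_iff by metis
      have "u \<in> closure (range (\<lambda>n. (T ^^ n) x))"
        using assms(1) x u unfolding minimal_tds_def by blast
      then obtain n where "dist ((T ^^ n) x) u < d"
        using d(1) unfolding closure_approachable by blast
      then have "dist ((S ^^ n) z) y < e"
        using d(2)[OF funpow_in[OF maps x(1)]] comm[OF x(1)] x u by simp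
      then show "\<exists>v\<in>range (\<lambda>n. (S ^^ n) z). dist v y < e" by blast
    qed
  qed
  then show ?thesis using \<open>tds Y S\<close> by (auto simp: minimal_tds_def)
qed

section \<open>Fibre diameters over an equicontinuous base\<close>

locale minimal_extension = minimal_system X T + base: equicontinuous_minimal_system Y S
  for X :: "'a::metric_space set" and T and Y :: "'b::metric_space set" and S +
  fixes f :: "'a \<Rightarrow> 'b"
  assumes factor: "factor_map X T Y S f"
begin

lemma cont_f: "continuous_on X f" and onto: "f ` X = Y" and equivariant: "x \<in> X \<Longrightarrow> f (T x) = S (f x)"
  using factor by (auto simp: factor_map_def)

lemma f_in: "x \<in> X \<Longrightarrow> f x \<in> Y"
  using onto by blast

lemma f_pow: "x \<in> X \<Longrightarrow> f ((T ^^ n) x) = (S ^^ n) (f x)"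
  using pow_in equivariant by (induction n) auto

lemma dist_le_diameter: "x \<in> A \<Longrightarrow> y \<in> A \<Longrightarrow> A \<subseteq> X \<Longrightarrow> dist x y \<le> diameter A"
  by (rule diameter_bounded_bound) (use bounded_subset[OF compact_imp_bounded[OF compact]] in auto)

lemma diameter_X_nonneg: "0 \<le> diameter X"
  by (rule diameter_ge_0[OF compact_imp_bounded[OF compact]])

text \<open>Upper semicontinuity of the fibres: the image of the compact set \<open>X - U\<close> is
  closed and misses y.\<close>

lemma fibre_neighbourhood:
  assumes "open U" "{x \<in> X. f x = y} \<subseteq> U"
  obtains \<eta> where "\<eta> > 0" "\<And>x. x \<in> X \<Longrightarrow> dist (f x) y < \<eta> \<Longrightarrow> x \<in> U"
proof -
  have "compact (X - U)" using compact \<open>open U\<close> by (rule compact_diff)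
  then have "compact (f ` (X - U))"
    using continuous_on_subset[OF cont_f] by (intro compact_continuous_image) auto
  then have "open (- f ` (X - U))" by (simp add: compact_imp_closed open_Compl)
  moreover have "y \<in> - f ` (X - U)" using assms(2) by blast
  ultimately obtain \<eta> where "\<eta> > 0" "ball y \<eta> \<subseteq> - f ` (X - U)"
    unfolding open_contains_ball by blast
  then show ?thesis by (intro that[of \<eta>]) (auto simp: dist_commute)
qed

text \<open>A continuous stand-in for the merely semicontinuous fibre diameter, to which it decreases
  as \<open>L \<rightarrow> \<infinity>\<close>.\<close>

definition spread :: "real \<Rightarrow> 'b \<Rightarrow> real" where
  "spread L y = (SUP p\<in>X \<times> X. dist (fst p) (snd p) - L * (dist (f (fst p)) y + dist (f (snd p)) y))"

lemma spread_least:
  assumes "\<And>x x'. x \<in> X \<Longrightarrow> x' \<in> X \<Longrightarrow> dist x x' - L * (dist (f x) y + dist (f x') y) \<le> c"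
  shows "spread L y \<le> c"
  unfolding spread_def by (rule cSUP_least) (use assms nonempty in auto)

context
  fixes L :: real
  assumes L: "0 \<le> L"
begin

lemma spread_upper:
  assumes "x \<in> X" "x' \<in> X"
  shows "dist x x' - L * (dist (f x) y + dist (f x') y) \<le> spread L y"
proof -
  have "dist a b - L * (dist (f a) y + dist (f b) y) \<le> diameter X" if "a \<in> X" "b \<in> X" for a b
    using dist_le_diameter[OF that] L by (smt (verit) mult_nonneg_nonneg subset_refl zero_le_dist)
  then have "bdd_above ((\<lambda>p. dist (fst p) (snd p) - L * (dist (f (fst p)) y + dist (f (snd p)) y)) ` (X \<times> X))"
    by (intro bdd_aboveI2[where M = "diameter X"]) auto
  then show ?thesis unfolding spread_def using assms by (intro cSUP_upper2[where x = "(x, x')"]) auto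
qed

lemma spread_le_diameter_space: "spread L y \<le> diameter X"
  by (rule spread_least) (use dist_le_diameter L in \<open>smt (verit) mult_nonneg_nonneg subset_refl zero_le_dist\<close>)

lemma spread_nonneg:
  assumes "y \<in> Y"
  shows "0 \<le> spread L y"
proof -
  obtain x where "x \<in> X" "f x = y" using assms onto by blast
  then show ?thesis using spread_upper[of x x y] by simp
qed

lemma spread_antimono:
  assumes "L \<le> L'"
  shows "spread L' y \<le> spread L y"
proof (rule spread_least)
  fix x x' assume "x \<in> X" "x' \<in> X"
  moreover have "L * (dist (f x) y + dist (f x') y) \<le> L' * (dist (f x) y + dist (f x') y)"
    by (intro mult_right_mono assms) auto
  ultimately show "dist x x' - L' * (dist (f x) y + dist (f x') y) \<le> spread L y"
    using spread_upper[of x x' y] by linarith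
qed

text \<open>Each function in the supremum is \<open>2 * L\<close>-Lipschitz in y by the triangle
  inequality.\<close>

lemma spread_lipschitz: "spread L y \<le> spread L z + 2 * L * dist y z"
proof (rule spread_least)
  fix x x' assume "x \<in> X" "x' \<in> X"
  moreover have "L * (dist (f x) z + dist (f x') z) \<le> L * (dist (f x) y + dist (f x') y + 2 * dist y z)"
    using L dist_triangle[of "f x" z y] dist_triangle[of "f x'" z y] by (intro mult_left_mono) auto
  ultimately show "dist x x' - L * (dist (f x) y + dist (f x') y) \<le> spread L z + 2 * L * dist y z"
    using spread_upper[of x x' z] by (simp add: algebra_simps)
qed

lemma continuous_on_spread: "continuous_on A (spread L)"
proof -
  have "dist (spread L y) (spread L z) \<le> 2 * L * dist y z" for y z
    using spread_lipschitz[of y z] spread_lipschitz[of z y]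
    by (simp add: dist_real_def abs_le_iff dist_commute)
  then have "(2 * L)-lipschitz_on A (spread L)" using L by (intro lipschitz_onI) auto
  then show ?thesis by (rule lipschitz_on_continuous_on)
qed

text \<open>For pairs in \<open>A\<close> the penalty subtracted in \<open>spread\<close> is at most
  \<open>2 * L * \<eta>\<close>.\<close>

lemma diameter_le_spread:
  assumes "A \<subseteq> X" "y \<in> Y" "\<And>x. x \<in> A \<Longrightarrow> dist (f x) y \<le> \<eta>" "0 \<le> \<eta>"
  shows "diameter A \<le> spread L y + 2 * L * \<eta>"
proof (rule diameter_least)
  show "0 \<le> spread L y + 2 * L * \<eta>" using spread_nonneg[OF assms(2)] L assms(4) by simp
  fix x x' assume x: "x \<in> A" "x' \<in> A"
  have "L * (dist (f x) y + dist (f x') y) \<le> L * (\<eta> + \<eta>)"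
    using L assms(3)[OF x(1)] assms(3)[OF x(2)] by (intro mult_left_mono) auto
  then show "dist x x' \<le> spread L y + 2 * L * \<eta>"
    using spread_upper[OF subsetD[OF assms(1) x(1)] subsetD[OF assms(1) x(2)], of y]
    by (simp add: algebra_simps)
qed

text \<open>A pair with a point outside \<open>A\<close> pays a penalty of at least
  \<open>L * \<rho>\<close>, which is at least the diameter of \<open>X\<close>, so it contributes
  nothing positive. Only pairs inside \<open>A\<close> remain.\<close>

lemma spread_le_diameter:
  assumes "A \<subseteq> X" "diameter X \<le> L * \<rho>" "\<And>x. x \<in> X \<Longrightarrow> dist (f x) y < \<rho> \<Longrightarrow> x \<in> A"
  shows "spread L y \<le> diameter A"
proof (rule spread_least)
  fix x x' assume x: "x \<in> X" "x' \<in> X"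
  have diam: "0 \<le> diameter A"
    by (rule diameter_ge_0) (rule bounded_subset[OF compact_imp_bounded[OF compact] assms(1)])
  have pos: "0 \<le> L * dist (f x) y" "0 \<le> L * dist (f x') y" using L by auto
  show "dist x x' - L * (dist (f x) y + dist (f x') y) \<le> diameter A"
  proof (cases "dist (f x) y < \<rho> \<and> dist (f x') y < \<rho>")
    case True
    then have "dist x x' \<le> diameter A" using assms x by (intro dist_le_diameter) auto
    then show ?thesis using pos by (simp add: algebra_simps)
  next
    case False
    then have "L * \<rho> \<le> L * dist (f x) y \<or> L * \<rho> \<le> L * dist (f x') y"
      using L by (auto intro: mult_left_mono)
    then show ?thesis using pos diam dist_le_diameter[OF x order_refl] assms(2)
      by (auto simp: distrib_left)
  qed
qed

end

text \<open>If the fibre is one point, points over a small ball about y lie in a small ball, and a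
  steep penalty removes all others. Conversely the penalty vanishes on the fibre, so every
  \<open>spread\<close> bounds distances within it.\<close>

lemma singleton_fibre_iff:
  assumes y: "y \<in> Y"
  shows "card {x \<in> X. f x = y} = 1 \<longleftrightarrow> (\<forall>e>0. \<exists>n::nat. spread (real n) y < e)"
proof
  assume "card {x \<in> X. f x = y} = 1"
  then obtain x where x: "{x \<in> X. f x = y} = {x}" by (auto simp: card_1_singleton_iff)
  show "\<forall>e>0. \<exists>n::nat. spread (real n) y < e"
  proof (intro allI impI)
    fix e :: real assume "e > 0"
    obtain \<eta> where \<eta>: "\<eta> > 0" "\<And>u. u \<in> X \<Longrightarrow> dist (f u) y < \<eta> \<Longrightarrow> u \<in> ball x (e / 3)"
      using fibre_neighbourhood[of "ball x (e / 3)" y] x \<open>e > 0\<close> by auto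
    obtain n :: nat where n: "diameter X / \<eta> \<le> real n" using real_arch_simple by blast
    have "spread (real n) y \<le> diameter (ball x (e / 3) \<inter> X)"
      by (rule spread_le_diameter[where \<rho> = \<eta>]) (use n \<eta> in \<open>auto simp: divide_le_eq\<close>)
    also have "\<dots> \<le> 2 * e / 3"
    proof (rule diameter_least)
      fix a b assume "a \<in> ball x (e / 3) \<inter> X" "b \<in> ball x (e / 3) \<inter> X"
      then show "dist a b \<le> 2 * e / 3" using dist_triangle3[of a b x] by auto
    qed (use \<open>e > 0\<close> in simp)
    finally show "\<exists>n::nat. spread (real n) y < e" using \<open>e > 0\<close> by (intro exI[of _ n]) simp
  qed
next
  assume small: "\<forall>e>0. \<exists>n::nat. spread (real n) y < e"
  obtain x where x: "x \<in> X" "f x = y" using y onto by blast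
  have "x' = x" if x': "x' \<in> X" "f x' = y" for x'
  proof (rule ccontr)
    assume "x' \<noteq> x"
    then obtain n :: nat where "spread (real n) y < dist x' x" using small by (meson zero_less_dist_iff)
    then show False using spread_upper[of "real n" x' x y] x x' by simp
  qed
  then have "{x \<in> X. f x = y} = {x}" using x by blast
  then show "card {x \<in> X. f x = y} = 1" by simp
qed

text \<open>One direction is dominated convergence, with the diameter of \<open>X\<close> as bound;
  the other is Markov's inequality at the levels 1/(k+1).\<close>

lemma regular_iff_small_spread:
  assumes \<nu>: "invariant_borel_prob Y S \<nu>"
  shows "regular_factor_map X Y \<nu> f \<longleftrightarrow> (\<forall>e>0. \<exists>n::nat. (\<integral>y. spread (real n) y \<partial>\<nu>) < e)"
proof -
  interpret prob_space \<nu> using \<nu> by (simp add: invariant_borel_prob_def)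
  have sets: "sets \<nu> = sets (restrict_space borel Y)" using \<nu> by (simp add: invariant_borel_prob_def)
  have space: "space \<nu> = Y" using sets_eq_imp_space_eq[OF sets] by (simp add: space_restrict_space)
  have meas[measurable]: "spread (real n) \<in> borel_measurable \<nu>" for n
    using borel_measurable_continuous_on_restrict[OF continuous_on_spread[of "real n"]]
      measurable_cong_sets[OF sets refl] by auto
  have bd: "0 \<le> spread (real n) y" "spread (real n) y \<le> diameter X" if "y \<in> Y" for n y
    using spread_nonneg spread_le_diameter_space that by auto
  have int: "integrable \<nu> (spread (real n))" for n
    by (rule integrable_const_bound[of _ "diameter X"]) (auto simp: space bd)
  define Y0 where "Y0 = {y \<in> Y. card {x \<in> X. f x = y} = 1}"
  \<comment> \<open>Restricting to the levels 1/(k+1) leaves countably many conditions, which makes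
    \<open>Y0\<close> measurable.\<close>
  have Y0: "Y0 = {y \<in> space \<nu>. \<forall>k. \<exists>n. spread (real n) y < inverse (real (Suc k))}"
  proof -
    have "(\<forall>e>0. \<exists>n::nat. spread (real n) y < e) \<longleftrightarrow> (\<forall>k. \<exists>n. spread (real n) y < inverse (real (Suc k)))" for y
    proof
      assume *: "\<forall>k. \<exists>n. spread (real n) y < inverse (real (Suc k))"
      show "\<forall>e>0. \<exists>n::nat. spread (real n) y < e"
        using reals_Archimedean * by (meson less_trans)
    qed simp
    then show ?thesis unfolding Y0_def space using singleton_fibre_iff by auto
  qed
  then have Y0_meas: "Y0 \<in> sets \<nu>" by simp
  have reg: "regular_factor_map X Y \<nu> f \<longleftrightarrow> (AE y in \<nu>. y \<in> Y0)"
    unfolding regular_factor_map_def Y0_def[symmetric] using prob_eq_1[OF Y0_meas] by simp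
  show ?thesis
  proof
    assume "regular_factor_map X Y \<nu> f"
    then have ae: "AE y in \<nu>. y \<in> Y0" using reg by simp
    have lim: "(\<lambda>n. spread (real n) y) \<longlonglongrightarrow> 0" if Y0: "y \<in> Y0" for y
    proof (rule LIMSEQ_I)
      fix e :: real assume "e > 0"
      have y: "y \<in> Y" using Y0 by (simp add: Y0_def)
      then obtain n :: nat where n: "spread (real n) y < e"
        using singleton_fibre_iff[OF y] Y0 \<open>e > 0\<close> unfolding Y0_def by blast
      have "norm (spread (real m) y - 0) < e" if "m \<ge> n" for m
        using spread_antimono[of "real n" "real m" y] that n bd[OF y, of m] by simp
      then show "\<exists>n0. \<forall>m\<ge>n0. norm (spread (real m) y - 0) < e" by blast
    qed
    have lim_int: "(\<lambda>n. \<integral>y. spread (real n) y \<partial>\<nu>) \<longlonglongrightarrow> (\<integral>y. 0 \<partial>\<nu>)"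
    proof (rule integral_dominated_convergence[where w = "\<lambda>_. diameter X"])
      show "AE y in \<nu>. (\<lambda>n. spread (real n) y) \<longlonglongrightarrow> 0" using ae by eventually_elim (rule lim)
    qed (auto simp: space bd)
    show "\<forall>e>0. \<exists>n::nat. (\<integral>y. spread (real n) y \<partial>\<nu>) < e"
      by (intro allI impI eventually_happens'[OF sequentially_bot] order_tendstoD(2)[OF lim_int]) simp
  next
    assume small: "\<forall>e>0. \<exists>n::nat. (\<integral>y. spread (real n) y \<partial>\<nu>) < e"
    have "AE y in \<nu>. \<exists>n. spread (real n) y < inverse (real (Suc k))" for k
    proof -
      let ?c = "inverse (real (Suc k))"
      let ?B = "{y \<in> space \<nu>. \<forall>n. ?c \<le> spread (real n) y}"
      have "measure \<nu> ?B = 0"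
      proof (rule antisym; rule field_le_epsilon)
        fix e :: real assume "e > 0"
        then obtain n :: nat where n: "(\<integral>y. spread (real n) y \<partial>\<nu>) < e * ?c"
          using small by (metis mult_pos_pos inverse_positive_iff_positive of_nat_0_less_iff zero_less_Suc)
        have "measure \<nu> ?B \<le> measure \<nu> {y \<in> space \<nu>. ?c \<le> spread (real n) y}"
          by (rule finite_measure_mono) auto
        also have "\<dots> \<le> (\<integral>y. spread (real n) y \<partial>\<nu>) / ?c"
          by (rule integral_Markov_inequality_measure[where A = "{}"]) (auto simp: int space bd)
        also have "\<dots> \<le> e" using n by (simp add: field_simps)
        finally show "measure \<nu> ?B \<le> 0 + e" by simp
      qed simp
      then have "AE y in \<nu>. y \<notin> ?B" by (subst AE_iff_measurable[OF _ refl]) (auto simp: emeasure_eq_measure)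
      then show ?thesis using AE_space by eventually_elim (auto simp: not_le)
    qed
    then have "AE y in \<nu>. \<forall>k. \<exists>n. spread (real n) y < inverse (real (Suc k))"
      by (simp add: AE_all_countable)
    then have "AE y in \<nu>. y \<in> Y0" using AE_space by eventually_elim (simp add: Y0)
    then show "regular_factor_map X Y \<nu> f" using reg by simp
  qed
qed

end

section \<open>Diam-mean equicontinuity and regularity\<close>

text \<open>Maximality only gives some map from \<open>Y\<close> onto a factor, with no relation to
  f and g. It is therefore applied to the joining \<open>W\<close> of the two factors, which carries
  its own projection back to \<open>Y\<close>.\<close>

lemma (in minimal_extension) maximal_factor_collapse:
  fixes Z :: "'c::metric_space set"
  assumes max: "maximal_equicontinuous_factor X T Y S f"
    and g: "factor_map X T Z R g" and R: "equicontinuous_tds Z R"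
    and x: "x \<in> X" "x' \<in> X" "f x = f x'"
  shows "g x = g x'"
proof -
  have g': "continuous_on X g" "g ` X = Z" "\<And>x. x \<in> X \<Longrightarrow> g (T x) = R (g x)"
    using g by (auto simp: factor_map_def)
  have R': "continuous_on Z R" "R ` Z \<subseteq> Z" using R by (auto simp: equicontinuous_tds_def tds_def)
  let ?k = "\<lambda>x. (f x, g x)" and ?Q = "map_prod S R"
  define W where "W = ?k ` X"
  have W: "W \<subseteq> Y \<times> Z" using onto g'(2) unfolding W_def by blast
  have contk: "continuous_on X ?k" by (intro continuous_on_Pair cont_f g'(1))
  have QW: "?Q ` W \<subseteq> W"
  proof -
    have "?Q (?k x) = ?k (T x)" if "x \<in> X" for x using that by (simp add: equivariant g'(3))
    then show ?thesis unfolding W_def using maps by force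
  qed
  have "continuous_on W (\<lambda>w. (S (fst w), R (snd w)))"
    by (intro continuous_on_Pair continuous_on_compose2[OF base.cont] continuous_on_compose2[OF R'(1)]
      continuous_on_fst continuous_on_snd continuous_on_id) (use W in auto)
  then have contQ: "continuous_on W ?Q" by (simp add: map_prod_def case_prod_beta')
  have "compact W" unfolding W_def by (rule compact_continuous_image[OF contk compact])
  then have tdsW: "tds W ?Q" using contQ QW by (simp add: tds_def)
  have pow: "(?Q ^^ n) (a, b) = ((S ^^ n) a, (R ^^ n) b)" for n a b by (induction n) auto
  have "\<exists>\<delta>>0. \<forall>v\<in>W. dist w v < \<delta> \<longrightarrow> (\<forall>n. dist ((?Q ^^ n) w) ((?Q ^^ n) v) < \<epsilon>)"
    if w: "w \<in> W" and "\<epsilon> > 0" for w and \<epsilon> :: real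
  proof -
    obtain a b where ab: "w = (a, b)" "a \<in> Y" "b \<in> Z" using w W by blast
    obtain d1 where d1: "d1 > 0" "\<And>y n. y \<in> Y \<Longrightarrow> dist a y < d1 \<Longrightarrow> dist ((S ^^ n) a) ((S ^^ n) y) < \<epsilon> / 2"
      using base.equicontinuous ab(2) \<open>\<epsilon> > 0\<close> unfolding equicontinuous_tds_def by (metis half_gt_zero)
    obtain d2 where d2: "d2 > 0" "\<And>z n. z \<in> Z \<Longrightarrow> dist b z < d2 \<Longrightarrow> dist ((R ^^ n) b) ((R ^^ n) z) < \<epsilon> / 2"
      using R ab(3) \<open>\<epsilon> > 0\<close> unfolding equicontinuous_tds_def by (metis half_gt_zero)
    have "dist ((?Q ^^ n) w) ((?Q ^^ n) v) < \<epsilon>" if v: "v \<in> W" "dist w v < min d1 d2" for v n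
    proof -
      obtain c d where cd: "v = (c, d)" "c \<in> Y" "d \<in> Z" using v W by blast
      have "dist a c \<le> dist w v" "dist b d \<le> dist w v"
        using dist_fst_le[of w v] dist_snd_le[of w v] ab(1) cd(1) by auto
      then have "dist ((S ^^ n) a) ((S ^^ n) c) < \<epsilon> / 2" "dist ((R ^^ n) b) ((R ^^ n) d) < \<epsilon> / 2"
        using d1(2)[OF cd(2)] d2(2)[OF cd(3)] v(2) by auto
      then show ?thesis
        using sqrt_sum_squares_le_sum[of "dist ((S ^^ n) a) ((S ^^ n) c)" "dist ((R ^^ n) b) ((R ^^ n) d)"]
        by (simp add: ab(1) cd(1) pow dist_Pair_Pair)
    qed
    then show ?thesis using d1(1) d2(1) by (intro exI[of _ "min d1 d2"]) auto
  qed
  then have "equicontinuous_tds W ?Q" using tdsW by (simp add: equicontinuous_tds_def)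
  moreover have "factor_map X T W ?Q ?k"
    using tds tdsW contk by (auto simp: factor_map_def W_def equivariant g'(3))
  ultimately obtain h where "factor_map Y S W ?Q h"
    using maximal_equicontinuous_factorD[OF max] by blast
  then have h: "continuous_on Y h" "h ` Y = W" "\<And>y. y \<in> Y \<Longrightarrow> h (S y) = ?Q (h y)"
    by (auto simp: factor_map_def)
  text \<open>\<open>h\<close> need not intertwine the factor maps, but \<open>fst \<circ> h\<close> is an endomorphism of \<open>Y\<close>, hence
    injective; so the projection of \<open>W\<close> to \<open>Y\<close> is injective.\<close>
  have "inj_on (\<lambda>y. fst (h y)) Y"
  proof (rule base.endomorphism_inj)
    show "(\<lambda>y. fst (h y)) ` Y \<subseteq> Y" using h(2) W by fastforce
  qed (use h in \<open>auto intro: continuous_on_fst\<close>)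
  then have inj: "w = v" if "w \<in> W" "v \<in> W" "fst w = fst v" for w v
    using that unfolding h(2)[symmetric] by (auto dest: inj_onD)
  have "?k x \<in> W" "?k x' \<in> W" using x(1,2) by (auto simp: W_def)
  from inj[OF this] show ?thesis using x(3) by simp
qed

lemma diam_mean_eventually:
  assumes "diam_mean_equicontinuity_point X T x" "\<epsilon> > 0"
  obtains \<delta> where "\<delta> > 0"
    "\<forall>\<^sub>F N in sequentially. (\<Sum>i=1..N. diameter ((T ^^ i) ` (ball x \<delta> \<inter> X))) \<le> \<epsilon> * real N"
proof -
  obtain \<delta> where "\<delta> > 0"
    "limsup (\<lambda>N. ereal ((1 / real N) * (\<Sum>i=1..N. diameter ((T ^^ i) ` (ball x \<delta> \<inter> X))))) < ereal \<epsilon>"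
    using assms unfolding diam_mean_equicontinuity_point_def by blast
  from Limsup_lessD[OF this(2)] eventually_gt_at_top[of "0::nat"]
  have "\<forall>\<^sub>F N in sequentially. (\<Sum>i=1..N. diameter ((T ^^ i) ` (ball x \<delta> \<inter> X))) \<le> \<epsilon> * real N"
    by eventually_elim (simp add: field_simps)
  then show ?thesis using that \<open>\<delta> > 0\<close> by blast
qed

lemma Banach_imp_diam_mean_equicontinuous:
  assumes "Banach_diam_mean_equicontinuous X T"
  shows "diam_mean_equicontinuous X T"
proof -
  have mean_le: "limsup (\<lambda>N. ereal ((1 / real N) * (\<Sum>i=1..N. a i)))
    \<le> limsup (\<lambda>n. SUP (M, N) \<in> {(M, N). M < N \<and> N - M = n}. ereal ((1 / real (N - M)) * (\<Sum>i=M+1..N. a i)))"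
    for a :: "nat \<Rightarrow> real"
  proof (rule Limsup_mono)
    show "\<forall>\<^sub>F n in sequentially. ereal ((1 / real n) * (\<Sum>i=1..n. a i))
      \<le> (SUP (M, N) \<in> {(M, N). M < N \<and> N - M = n}. ereal ((1 / real (N - M)) * (\<Sum>i=M+1..N. a i)))"
      using eventually_gt_at_top[of "0::nat"]
    proof eventually_elim
      case (elim n)
      \<comment> \<open>The ordinary mean is the window with M = 0.\<close>
      then show ?case by (intro SUP_upper2[where i = "(0, n)"]) auto
    qed
  qed
  have "diam_mean_equicontinuity_point X T x" if "Banach_diam_mean_equicontinuity_point X T x" for x
    unfolding diam_mean_equicontinuity_point_def
  proof (intro allI impI)
    fix \<epsilon> :: real assume "\<epsilon> > 0"
    from that[unfolded Banach_diam_mean_equicontinuity_point_def, rule_format, OF this]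
    show "\<exists>\<delta>>0. limsup (\<lambda>N. ereal ((1 / real N) * (\<Sum>i=1..N. diameter ((T ^^ i) ` (ball x \<delta> \<inter> X))))) < ereal \<epsilon>"
    proof (elim exE conjE)
      fix \<delta> :: real
      assume "\<delta> > 0"
        and less: "limsup (\<lambda>n. SUP (M, N) \<in> {(M, N). M < N \<and> N - M = n}.
          ereal ((1 / real (N - M)) * (\<Sum>i=M+1..N. diameter ((T ^^ i) ` (ball x \<delta> \<inter> X))))) < ereal \<epsilon>"
      show ?thesis
        by (rule exI[of _ \<delta>], rule conjI[OF \<open>\<delta> > 0\<close>], rule le_less_trans[OF mean_le less])
    qed
  qed
  then show ?thesis
    using assms by (simp add: Banach_diam_mean_equicontinuous_def diam_mean_equicontinuous_def)
qed

section \<open>The two implications between mean diameters and regularity\<close>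

context minimal_extension
begin

text \<open>A radius that works at x works, after shrinking, at all nearby points, so compactness
  yields a common one. It must be fixed before the small fibre is found, whose position depends on
  it; the threshold for N may still vary with x.\<close>

lemma diam_mean_uniform:
  assumes dme: "diam_mean_equicontinuous X T" and "\<epsilon> > 0"
  obtains \<delta> where "\<delta> > 0" "\<And>x. x \<in> X \<Longrightarrow>
    \<forall>\<^sub>F N in sequentially. (\<Sum>i=1..N. diameter ((T ^^ i) ` (ball x \<delta> \<inter> X))) \<le> \<epsilon> * real N"
proof -
  let ?E = "\<lambda>x \<delta>. \<forall>\<^sub>F N in sequentially. (\<Sum>i=1..N. diameter ((T ^^ i) ` (ball x \<delta> \<inter> X))) \<le> \<epsilon> * real N"
  have shrink: "?E y \<gamma>" if E: "?E x \<delta>" and sub: "ball y \<gamma> \<subseteq> ball x \<delta>" for x y \<gamma> \<delta>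
    using E
  proof eventually_elim
    case (elim N)
    have "diameter ((T ^^ i) ` (ball y \<gamma> \<inter> X)) \<le> diameter ((T ^^ i) ` (ball x \<delta> \<inter> X))" for i
      by (rule diameter_subset)
        (use sub in blast, use pow_in in \<open>blast intro: bounded_subset[OF compact_imp_bounded[OF compact]]\<close>)
    then have "(\<Sum>i=1..N. diameter ((T ^^ i) ` (ball y \<gamma> \<inter> X)))
      \<le> (\<Sum>i=1..N. diameter ((T ^^ i) ` (ball x \<delta> \<inter> X)))" by (rule sum_mono)
    with elim show ?case by linarith
  qed
  obtain m where m: "\<And>x. x \<in> X \<Longrightarrow> \<exists>k\<le>m. ?E x (inverse (real (Suc k)))"
  proof (rule compact_uniform_index[OF compact, of "\<lambda>k x. ?E x (inverse (real (Suc k)))"])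
    fix x assume "x \<in> X"
    then have "diam_mean_equicontinuity_point X T x" using dme by (simp add: diam_mean_equicontinuous_def)
    then obtain \<delta> where \<delta>: "\<delta> > 0" "?E x \<delta>" by (rule diam_mean_eventually[OF _ \<open>\<epsilon> > 0\<close>])
    obtain k where k: "inverse (real (Suc k)) < \<delta> / 2" using reals_Archimedean[of "\<delta> / 2"] \<delta>(1) by auto
    have "?E y (inverse (real (Suc k)))" if "dist x y < \<delta> / 2" for y
    proof (rule shrink[OF \<delta>(2)], rule subsetI)
      fix z assume "z \<in> ball y (inverse (real (Suc k)))"
      then show "z \<in> ball x \<delta>" using that k dist_triangle[of x z y] by (simp only: mem_ball)
    qed
    then show "\<exists>k. \<exists>e>0. \<forall>y\<in>X. dist x y < e \<longrightarrow> ?E y (inverse (real (Suc k)))"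
      using \<delta>(1) by (intro exI[of _ k] exI[of _ "\<delta> / 2"]) auto
  qed blast
  show ?thesis
  proof (rule that[of "inverse (real (Suc m))"])
    fix x assume "x \<in> X"
    then obtain k where k: "k \<le> m" "?E x (inverse (real (Suc k)))" using m by blast
    have "inverse (real (Suc m)) \<le> inverse (real (Suc k))" using k(1) by (intro le_imp_inverse_le) auto
    then show "?E x (inverse (real (Suc m)))" by (intro shrink[OF k(2)] subset_ball)
  qed simp
qed

lemma pow_image_subset: "A \<subseteq> X \<Longrightarrow> (T ^^ n) ` A \<subseteq> X"
  using pow_in by blast

lemma dist_le_diameter_X: "x \<in> X \<Longrightarrow> y \<in> X \<Longrightarrow> dist x y \<le> diameter X"
  by (rule dist_le_diameter) auto

text \<open>\<open>D\<close> vanishes on pairs in a common fibre because the factor it defines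
  collapses the fibres. These pairs form a compact invariant set, on which
  \<open>uniform_small_averages\<close> makes the rate uniform.\<close>

lemma uniform_mean_proximality:
  assumes max: "maximal_equicontinuous_factor X T Y S f" and dme: "diam_mean_equicontinuous X T"
    and "\<eta> > 0"
  obtains N0 where "\<And>N x x'. N \<ge> N0 \<Longrightarrow> x \<in> X \<Longrightarrow> x' \<in> X \<Longrightarrow> f x = f x' \<Longrightarrow>
    (\<Sum>i<N. dist ((T ^^ i) x) ((T ^^ i) x')) \<le> \<eta> * real N"
proof -
  let ?C = "diameter X"
  let ?a = "\<lambda>x y i. dist ((T ^^ i) x) ((T ^^ i) y)"
  define D where "D x y = upper_mean (?a x y)" for x y
  have a: "0 \<le> ?a x y i" "?a x y i \<le> ?C" if "x \<in> X" "y \<in> X" for x y i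
    using dist_le_diameter_X[OF pow_in[OF that(1)] pow_in[OF that(2)]] by auto
  obtain Z :: "(nat \<Rightarrow>\<^sub>C real) set" and R g where g: "factor_map X T Z R g" "equicontinuous_tds Z R"
    "\<And>x y. x \<in> X \<Longrightarrow> y \<in> X \<Longrightarrow> dist (g x) (g y) = D x y"
  proof (rule invariant_pseudometric_factor[of D ?C])
    fix x y z assume xyz: "x \<in> X" "y \<in> X" "z \<in> X"
    show "D x z \<le> D x y + D y z" unfolding D_def
      by (rule upper_mean_add[of _ ?C]) (use xyz in \<open>auto simp: a dist_triangle\<close>)
  next
    fix x y assume xy: "x \<in> X" "y \<in> X"
    show "0 \<le> D x y" unfolding D_def by (rule upper_mean_nonneg[of _ ?C]) (use a xy in auto)
    show "D x y \<le> ?C" unfolding D_def by (rule upper_mean_bounded) (use a xy in auto)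
    show "D x y = D y x" unfolding D_def by (simp add: dist_commute)
    show "D (T x) (T y) = D x y"
      using upper_mean_shift[of "?a x y" ?C] a[OF xy] unfolding D_def by (simp add: funpow_swap1)
  next
    fix x assume x: "x \<in> X"
    have "D x x \<le> 0" unfolding D_def by (rule upper_mean_le[of _ ?C]) (use diameter_X_nonneg in auto)
    moreover have "0 \<le> D x x" unfolding D_def
      by (rule upper_mean_nonneg[of _ ?C]) (use diameter_X_nonneg in auto)
    ultimately show "D x x = 0" by simp
    fix e :: real assume "e > 0"
    then obtain \<delta> where \<delta>: "\<delta> > 0"
      "\<forall>\<^sub>F N in sequentially. (\<Sum>i=1..N. diameter ((T ^^ i) ` (ball x \<delta> \<inter> X))) \<le> e / 2 * real N"
      using diam_mean_eventually[of X T x "e / 2"] dme x unfolding diam_mean_equicontinuous_def by auto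
    \<comment> \<open>Here diam-mean equicontinuity enters: it makes \<open>D\<close>
      continuous.\<close>
    have "D x y < e" if y: "y \<in> X" "dist x y < \<delta>" for y
    proof -
      have le: "?a x y i \<le> diameter ((T ^^ i) ` (ball x \<delta> \<inter> X))" for i
        by (rule dist_le_diameter) (use x y \<delta>(1) pow_in in auto)
      have "\<forall>\<^sub>F N in sequentially. (\<Sum>i=1..N. ?a x y i) \<le> e / 2 * real N"
        using \<delta>(2) by eventually_elim (rule order_trans[OF sum_mono[OF le]])
      then have "D x y \<le> e / 2" unfolding D_def by (rule upper_mean_le[of _ ?C, rotated 2]) (use a x y in auto)
      then show ?thesis using \<open>e > 0\<close> by simp
    qed
    then show "\<exists>d>0. \<forall>y\<in>X. dist x y < d \<longrightarrow> D x y < e" using \<delta>(1) by blast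
  qed (use that in blast)
  \<comment> \<open>The equality of images is written as distance 0 so that \<open>K\<close> is
    visibly a closed preimage of a constant.\<close>
  define K where "K = {p \<in> X \<times> X. dist (f (fst p)) (f (snd p)) = 0}"
  have K: "p \<in> K \<longleftrightarrow> fst p \<in> X \<and> snd p \<in> X \<and> f (fst p) = f (snd p)" for p
    by (auto simp: K_def mem_Times_iff)
  have comp: "compact (X \<times> X)" by (intro compact_Times compact)
  have cf: "continuous_on (X \<times> X) (\<lambda>p. f (fst p))" "continuous_on (X \<times> X) (\<lambda>p. f (snd p))"
    by (rule continuous_on_compose2[OF cont_f]; auto intro: continuous_on_fst continuous_on_snd)+
  have "closed K" unfolding K_def
    by (rule continuous_closed_preimage_constant[OF continuous_on_dist[OF cf] compact_imp_closed[OF comp]])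
  then have "compact ((X \<times> X) \<inter> K)" using comp by (rule compact_Int_closed[rotated])
  moreover have "(X \<times> X) \<inter> K = K" by (auto simp: K_def)
  ultimately have compK: "compact K" by simp
  have "continuous_on K (\<lambda>p. (T (fst p), T (snd p)))"
    by (intro continuous_on_Pair; rule continuous_on_compose2[OF cont])
      (auto simp: K intro: continuous_on_fst continuous_on_snd)
  then have contT: "continuous_on K (map_prod T T)" by (simp add: map_prod_def case_prod_beta')
  have mapsK: "map_prod T T ` K \<subseteq> K" using pow_in[of _ 1] equivariant by (auto simp: K)
  have pow: "(map_prod T T ^^ n) p = ((T ^^ n) (fst p), (T ^^ n) (snd p))" for n p
    by (induction n) auto
  obtain N0 where N0: "\<And>N r. N \<ge> N0 \<Longrightarrow> r \<in> K \<Longrightarrow>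
    (\<Sum>i<N. (\<lambda>p. dist (fst p) (snd p)) ((map_prod T T ^^ i) r)) \<le> 2 * (\<eta> / 2) * real N"
  proof (rule uniform_small_averages[OF compK contT mapsK, of "\<lambda>p. dist (fst p) (snd p)" "\<eta> / 2"])
    fix r assume r: "r \<in> K"
    then have r': "fst r \<in> X" "snd r \<in> X" "f (fst r) = f (snd r)" by (auto simp: K)
    have "D (fst r) (snd r) = 0"
      using maximal_factor_collapse[OF max g(1,2) r'] g(3)[OF r'(1,2)] by simp
    \<comment> \<open>The upper mean controls times 1 to N, whereas blocks run over times 0 to N-1.
      The extra term at time 0 is at most \<open>?C\<close>, which a large N absorbs; this uses up
      the second \<eta>/4.\<close>
    then have "\<forall>\<^sub>F N in sequentially. (\<Sum>i=1..N. ?a (fst r) (snd r) i) \<le> \<eta> / 4 * real N"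
      unfolding D_def using \<open>\<eta> > 0\<close> by (intro upper_mean_less[of _ ?C] a r') auto
    moreover obtain n1 :: nat where n1: "?C / (\<eta> / 4) < real n1" using reals_Archimedean2 by blast
    ultimately have "\<forall>\<^sub>F N in sequentially. (\<Sum>i=1..N. ?a (fst r) (snd r) i) \<le> \<eta> / 4 * real N \<and> n1 \<le> N \<and> 1 \<le> N"
      using eventually_ge_at_top[of n1] eventually_ge_at_top[of 1] by (simp add: eventually_conj)
    then obtain N where N: "(\<Sum>i=1..N. ?a (fst r) (snd r) i) \<le> \<eta> / 4 * real N" "n1 \<le> N" "1 \<le> N"
      using eventually_happens'[OF sequentially_bot] by blast
    have "?C / (\<eta> / 4) < real N" using n1 N(2) by linarith
    then have "?C < \<eta> / 4 * real N" using \<open>\<eta> > 0\<close> by (simp add: field_simps)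
    moreover have "(\<Sum>i<N. ?a (fst r) (snd r) i) \<le> ?a (fst r) (snd r) 0 + (\<Sum>i=1..N. ?a (fst r) (snd r) i)"
      using sum.lessThan_Suc_shift[of "?a (fst r) (snd r)" N] zero_le_dist[of "(T ^^ N) (fst r)" "(T ^^ N) (snd r)"]
      unfolding One_nat_def sum.atLeast1_atMost_eq sum.lessThan_Suc[of "?a (fst r) (snd r)" N] by linarith
    ultimately have "(\<Sum>i<N. ?a (fst r) (snd r) i) < \<eta> / 2 * real N"
      using N(1) a(2)[OF r'(1,2), of 0] by linarith
    then show "\<exists>n\<ge>1. (\<Sum>i<n. dist (fst ((map_prod T T ^^ i) r)) (snd ((map_prod T T ^^ i) r))) < \<eta> / 2 * real n"
      using N(3) unfolding pow by auto
  qed (use \<open>\<eta> > 0\<close> in \<open>auto intro!: continuous_intros\<close>)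
  show ?thesis
  proof (rule that)
    fix N x x' assume "N \<ge> N0" "x \<in> X" "x' \<in> X" "f x = f x'"
    then show "(\<Sum>i<N. dist ((T ^^ i) x) ((T ^^ i) x')) \<le> \<eta> * real N"
      using N0[of N "(x, x')"] by (simp add: K pow)
  qed
qed

text \<open>If every fibre had diameter at least \<open>c\<close>, then the images of any ball would have diameter
  at least \<open>c\<close> about half of the time: pull far-apart pairs of fibres along an orbit back by \<open>n\<close>
  steps; for most \<open>n\<close> the pull-backs follow the orbit of a single point \<open>p\<close>, and for one of them
  that orbit is in the ball.\<close>

lemma small_fibre:
  assumes max: "maximal_equicontinuous_factor X T Y S f" and dme: "diam_mean_equicontinuous X T"
    and "c > 0"
  obtains y where "y \<in> Y" "\<And>x x'. x \<in> X \<Longrightarrow> x' \<in> X \<Longrightarrow> f x = y \<Longrightarrow> f x' = y \<Longrightarrow> dist x x' < c"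
proof (rule ccontr)
  note witness = that
  assume no_witness: "\<not> thesis"
  have far: "\<exists>x\<in>X. \<exists>x'\<in>X. f x = y \<and> f x' = y \<and> c \<le> dist x x'" if "y \<in> Y" for y
    using witness[OF that] no_witness by (auto simp: not_less[symmetric])
  obtain p where p: "p \<in> X" using nonempty by blast
  \<comment> \<open>Any preimage under \<open>T ^^ k\<close> of a point over
    \<open>(S ^^ k) (f p)\<close> lies over \<open>f p\<close>, because \<open>S ^^ k\<close> is
    injective.\<close>
  have pre: "\<exists>u\<in>X. f u = f p \<and> (T ^^ k) u = x" if "x \<in> X" "f x = (S ^^ k) (f p)" for x k
  proof -
    have "x \<in> (T ^^ k) ` X" using that(1) by (simp add: surj_pow)
    then obtain u where u: "u \<in> X" "x = (T ^^ k) u" by blast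
    then have "(S ^^ k) (f u) = (S ^^ k) (f p)" using f_pow that(2) by simp
    then have "f u = f p" using inj_onD[OF base.inj_pow] f_in u(1) p by blast
    then show ?thesis using u by blast
  qed
  have "\<exists>u u'. u \<in> X \<and> u' \<in> X \<and> f u = f p \<and> f u' = f p \<and> c \<le> dist ((T ^^ k) u) ((T ^^ k) u')" for k
    using far[OF base.pow_in[OF f_in[OF p]], of k] pre by metis
  then obtain u u' where u: "\<And>k. u k \<in> X" "\<And>k. f (u k) = f p" and u': "\<And>k. u' k \<in> X" "\<And>k. f (u' k) = f p"
    and dist_u: "\<And>k. c \<le> dist ((T ^^ k) (u k)) ((T ^^ k) (u' k))"
    by metis
  obtain \<delta> where \<delta>: "\<delta> > 0"
    "\<forall>\<^sub>F N in sequentially. (\<Sum>i=1..N. diameter ((T ^^ i) ` (ball p \<delta> \<inter> X))) \<le> c / 4 * real N"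
    using diam_mean_eventually[of X T p "c / 4"] dme p \<open>c > 0\<close> unfolding diam_mean_equicontinuous_def by auto
  obtain m where m: "\<And>y. y \<in> X \<Longrightarrow> \<exists>j\<le>m. dist ((T ^^ j) y) p < \<delta> / 2"
    using hitting_time[OF p, of "\<delta> / 2"] \<delta>(1) by (metis half_gt_zero)
  \<comment> \<open>Chosen so that \<open>2 * c / \<delta>\<close> times m+1 copies of
    \<open>2 * \<eta>\<close> equals c/2 below.\<close>
  define \<eta> where "\<eta> = \<delta> / (8 * real (Suc m))"
  have "\<eta> > 0" using \<delta>(1) by (simp add: \<eta>_def)
  obtain N0 where N0: "\<And>N x x'. N \<ge> N0 \<Longrightarrow> x \<in> X \<Longrightarrow> x' \<in> X \<Longrightarrow> f x = f x' \<Longrightarrow>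
    (\<Sum>i<N. dist ((T ^^ i) x) ((T ^^ i) x')) \<le> \<eta> * real N"
    using uniform_mean_proximality[OF max dme \<open>\<eta> > 0\<close>] by blast
  have large: "c / 2 * real N \<le> (\<Sum>i=1..N. diameter ((T ^^ i) ` (ball p \<delta> \<inter> X)))" if N: "N \<ge> N0" for N
  proof -
    let ?d = "\<lambda>n. diameter ((T ^^ n) ` (ball p \<delta> \<inter> X))"
    let ?b = "\<lambda>v i j. dist ((T ^^ i) ((T ^^ j) v)) ((T ^^ i) ((T ^^ j) p))"
    let ?a = "\<lambda>i j. ?b (u (N + j)) i j + ?b (u' (N + j)) i j"
    \<comment> \<open>Take j with \<open>(T ^^ (i + j)) p\<close> within \<delta>/2 of p. Either the
      pair of index N+j still follows p at time i+j, so it lies in the ball and is c apart after the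
      remaining N-i steps; or the deviation is at least \<delta>/2 and the second term is at least
      c. Summing over all j \<le> m removes the dependence of j on i.\<close>
    have "c \<le> ?d (N - i) + 2 * c / \<delta> * (\<Sum>j\<le>m. ?a i j)" if i: "i < N" for i
    proof -
      obtain j where j: "j \<le> m" "dist ((T ^^ j) ((T ^^ i) p)) p < \<delta> / 2" using m[OF pow_in[OF p]] by blast
      have hit: "dist ((T ^^ i) ((T ^^ j) p)) p < \<delta> / 2"
        using j(2) by (metis add.commute comp_apply funpow_add)
      have A: "?d (N - i) \<ge> 0"
        by (rule diameter_ge_0) (use pow_in in \<open>blast intro: bounded_subset[OF compact_imp_bounded[OF compact]]\<close>)
      have ge: "?a i j \<le> (\<Sum>j\<le>m. ?a i j)" by (rule member_le_sum) (use j in auto)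
      show ?thesis
      proof (cases "?a i j < \<delta> / 2")
        case True
        have near: "(T ^^ (i + j)) v \<in> ball p \<delta> \<inter> X" if "v \<in> X" "?b v i j < \<delta> / 2" for v
          using that hit dist_triangle[of "(T ^^ i) ((T ^^ j) v)" p "(T ^^ i) ((T ^^ j) p)"]
            pow_in[of v "i + j"] by (simp add: funpow_add dist_commute)
        have comp: "(T ^^ (N - i)) ((T ^^ (i + j)) v) = (T ^^ (N + j)) v" for v
          using i by (metis add.assoc comp_apply funpow_add le_add_diff_inverse2 less_imp_le)
        have "c \<le> dist ((T ^^ (N - i)) ((T ^^ (i + j)) (u (N + j)))) ((T ^^ (N - i)) ((T ^^ (i + j)) (u' (N + j))))"
          unfolding comp by (rule dist_u)
        also have "\<dots> \<le> ?d (N - i)"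
        proof (rule dist_le_diameter)
          show "(T ^^ (N - i)) ` (ball p \<delta> \<inter> X) \<subseteq> X" by (rule pow_image_subset) blast
          have "?b (u (N + j)) i j < \<delta> / 2" "?b (u' (N + j)) i j < \<delta> / 2"
            using True zero_le_dist by (smt (verit))+
          then show "(T ^^ (N - i)) ((T ^^ (i + j)) (u (N + j))) \<in> (T ^^ (N - i)) ` (ball p \<delta> \<inter> X)"
            "(T ^^ (N - i)) ((T ^^ (i + j)) (u' (N + j))) \<in> (T ^^ (N - i)) ` (ball p \<delta> \<inter> X)"
            using near[OF u(1)] near[OF u'(1)] by auto
        qed
        finally have "c \<le> ?d (N - i)" .
        moreover have "0 \<le> 2 * c / \<delta> * (\<Sum>j\<le>m. ?a i j)"
          using \<open>c > 0\<close> \<delta>(1) by (intro mult_nonneg_nonneg sum_nonneg) auto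
        ultimately show ?thesis by linarith
      next
        case False
        have "c = 2 * c / \<delta> * (\<delta> / 2)" using \<delta>(1) by simp
        also have "\<dots> \<le> 2 * c / \<delta> * (\<Sum>j\<le>m. ?a i j)"
          using False ge \<open>c > 0\<close> \<delta>(1) by (intro mult_left_mono) auto
        finally show ?thesis using A by linarith
      qed
    qed
    then have "(\<Sum>i<N. c) \<le> (\<Sum>i<N. ?d (N - i) + 2 * c / \<delta> * (\<Sum>j\<le>m. ?a i j))"
      by (intro sum_mono) auto
    also have "\<dots> = (\<Sum>i<N. ?d (N - i)) + 2 * c / \<delta> * (\<Sum>j\<le>m. \<Sum>i<N. ?a i j)"
      unfolding sum.distrib[of "\<lambda>i. ?d (N - i)"] sum_distrib_left[symmetric]
      by (subst sum.swap) (rule refl)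
    also have "(\<Sum>i<N. ?d (N - i)) = (\<Sum>i=1..N. ?d i)"
      using sum.nat_diff_reindex[of "\<lambda>i. ?d (Suc i)" N]
      by (simp add: sum.atLeast1_atMost_eq Suc_diff_Suc cong: sum.cong_simp)
    \<comment> \<open>For fixed j the points \<open>(T ^^ j) (u (N + j))\<close> and
      \<open>(T ^^ j) p\<close> share a fibre, so the uniform estimate applies although the pairs
      change with N.\<close>
    also have "2 * c / \<delta> * (\<Sum>j\<le>m. \<Sum>i<N. ?a i j) \<le> 2 * c / \<delta> * (\<Sum>j\<le>m. 2 * \<eta> * real N)"
    proof (intro mult_left_mono sum_mono)
      fix j
      have "f ((T ^^ j) (u (N + j))) = f ((T ^^ j) p)" "f ((T ^^ j) (u' (N + j))) = f ((T ^^ j) p)"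
        using u u' p by (simp_all add: f_pow)
      then have "(\<Sum>i<N. ?b (u (N + j)) i j) \<le> \<eta> * real N" "(\<Sum>i<N. ?b (u' (N + j)) i j) \<le> \<eta> * real N"
        using N by (auto intro!: N0 pow_in u u' p)
      then show "(\<Sum>i<N. ?a i j) \<le> 2 * \<eta> * real N" by (simp add: sum.distrib)
    qed (use \<open>c > 0\<close> \<delta>(1) in simp)
    also have "2 * c / \<delta> * (\<Sum>j\<le>m. 2 * \<eta> * real N) = 4 * c / \<delta> * (real (Suc m) * \<eta>) * real N"
      by simp
    also have "\<dots> = c / 2 * real N"
      using \<delta>(1) by (simp add: \<eta>_def del: of_nat_Suc)
    finally show ?thesis by (simp add: algebra_simps)
  qed
  have "\<forall>\<^sub>F N in sequentially. N \<ge> N0 \<and> N \<ge> 1 \<and>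
      (\<Sum>i=1..N. diameter ((T ^^ i) ` (ball p \<delta> \<inter> X))) \<le> c / 4 * real N"
    using \<delta>(2) eventually_ge_at_top[of N0] eventually_ge_at_top[of 1] by (simp add: eventually_conj)
  then obtain N where N: "N \<ge> N0" "N \<ge> 1" "(\<Sum>i=1..N. diameter ((T ^^ i) ` (ball p \<delta> \<inter> X))) \<le> c / 4 * real N"
    using eventually_happens'[OF sequentially_bot] by blast
  have "c / 2 * real N \<le> c / 4 * real N" using large[OF N(1)] N(3) by linarith
  then show False using \<open>c > 0\<close> N(2) by simp
qed

lemma diam_mean_imp_regular:
  assumes max: "maximal_equicontinuous_factor X T Y S f" and dme: "diam_mean_equicontinuous X T"
    and \<nu>: "invariant_borel_prob Y S \<nu>"
  shows "regular_factor_map X Y \<nu> f"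
  unfolding regular_iff_small_spread[OF \<nu>]
proof (intro allI impI)
  fix e :: real assume "e > 0"
  obtain \<delta> where \<delta>: "\<delta> > 0" "\<And>x. x \<in> X \<Longrightarrow>
    \<forall>\<^sub>F N in sequentially. (\<Sum>i=1..N. diameter ((T ^^ i) ` (ball x \<delta> \<inter> X))) \<le> e / 4 * real N"
    using diam_mean_uniform[OF dme, of "e / 4"] \<open>e > 0\<close> by auto
  obtain y where y: "y \<in> Y" "\<And>x x'. x \<in> X \<Longrightarrow> x' \<in> X \<Longrightarrow> f x = y \<Longrightarrow> f x' = y \<Longrightarrow> dist x x' < \<delta>"
    using small_fibre[OF max dme \<delta>(1)] by metis
  obtain u where u: "u \<in> X" "f u = y" using y(1) onto by blast
  obtain \<eta> where \<eta>: "\<eta> > 0" "\<And>x. x \<in> X \<Longrightarrow> dist (f x) y < \<eta> \<Longrightarrow> x \<in> ball u \<delta>"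
  proof (rule fibre_neighbourhood[of "ball u \<delta>" y])
    show "{x \<in> X. f x = y} \<subseteq> ball u \<delta>" using y(2)[OF u(1) _ u(2)] by auto
  qed (use that in auto)
  \<comment> \<open>One \<rho> serves all times: a point over the \<rho>-ball about
    \<open>(S ^^ i) y\<close> has its i-th preimages over the \<eta>-ball about y, hence in
    \<open>ball u \<delta>\<close>.\<close>
  obtain \<rho> where \<rho>: "\<rho> > 0"
    "\<And>a b n. a \<in> Y \<Longrightarrow> b \<in> Y \<Longrightarrow> dist ((S ^^ n) a) ((S ^^ n) b) < \<rho> \<Longrightarrow> dist a b < \<eta>"
    using base.inverse_equicontinuity[OF \<eta>(1)] by metis
  obtain n :: nat where "diameter X / \<rho> \<le> real n" using real_arch_simple by blast
  then have n: "diameter X \<le> real n * \<rho>" using \<rho>(1) by (simp add: divide_le_eq)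
  have le: "spread (real n) ((S ^^ i) y) \<le> diameter ((T ^^ i) ` (ball u \<delta> \<inter> X))" for i
  proof (rule spread_le_diameter[OF _ _ n])
    show "(T ^^ i) ` (ball u \<delta> \<inter> X) \<subseteq> X" by (rule pow_image_subset) blast
    fix x assume x: "x \<in> X" "dist (f x) ((S ^^ i) y) < \<rho>"
    have "x \<in> (T ^^ i) ` X" using x(1) by (simp add: surj_pow)
    then obtain w where w: "w \<in> X" "x = (T ^^ i) w" by blast
    then have "dist (f w) y < \<eta>" using \<rho>(2)[OF f_in y(1)] x(2) f_pow by simp
    then show "x \<in> (T ^^ i) ` (ball u \<delta> \<inter> X)" using \<eta>(2) w by blast
  qed simp
  let ?I = "\<integral>y. spread (real n) y \<partial>\<nu>"
  obtain n0 where n0: "\<And>N z. N \<ge> n0 \<Longrightarrow> z \<in> Y \<Longrightarrow>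
    \<bar>(\<Sum>i<N. spread (real n) ((S ^^ i) z)) - real N * ?I\<bar> \<le> e / 4 * real N"
    using base.averages_converge_uniformly[OF \<nu> continuous_on_spread[of "real n"], of "e / 4"] \<open>e > 0\<close> by auto
  have "\<forall>\<^sub>F N in sequentially. N \<ge> n0 \<and> N \<ge> 1 \<and>
      (\<Sum>i=1..N. diameter ((T ^^ i) ` (ball u \<delta> \<inter> X))) \<le> e / 4 * real N"
    using \<delta>(2)[OF u(1)] eventually_ge_at_top[of n0] eventually_ge_at_top[of 1] by (simp add: eventually_conj)
  then obtain N where N: "N \<ge> n0" "N \<ge> 1" "(\<Sum>i=1..N. diameter ((T ^^ i) ` (ball u \<delta> \<inter> X))) \<le> e / 4 * real N"
    using eventually_happens'[OF sequentially_bot] by blast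
  \<comment> \<open>The mean diameters start at time 1, so the ergodic average is taken from
    \<open>S y\<close>.\<close>
  have "(\<Sum>i<N. spread (real n) ((S ^^ i) (S y))) = (\<Sum>i=1..N. spread (real n) ((S ^^ i) y))"
    using sum_shift_funpow[of "spread (real n)" S y 0 N] by simp
  also have "\<dots> \<le> e / 4 * real N" using sum_mono[where K = "{1..N}", OF le] N(3) by (meson order_trans)
  finally have "real N * ?I \<le> real N * (e / 2)"
    using abs_le_D2[OF n0[OF N(1) base.pow_in[OF y(1), of 1]]] by (simp add: algebra_simps)
  then have "?I \<le> e / 2" using N(2) by simp
  then show "\<exists>n::nat. (\<integral>y. spread (real n) y \<partial>\<nu>) < e" using \<open>e > 0\<close> by (intro exI[of _ n]) simp
qed

lemma regular_imp_Banach_diam_mean: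
  assumes \<nu>: "invariant_borel_prob Y S \<nu>" and reg: "regular_factor_map X Y \<nu> f"
  shows "Banach_diam_mean_equicontinuous X T"
  unfolding Banach_diam_mean_equicontinuous_def Banach_diam_mean_equicontinuity_point_def
proof (intro ballI allI impI)
  fix x and \<epsilon> :: real assume x: "x \<in> X" and "\<epsilon> > 0"
  obtain n :: nat where n: "(\<integral>y. spread (real n) y \<partial>\<nu>) < \<epsilon> / 4"
    using reg \<open>\<epsilon> > 0\<close> unfolding regular_iff_small_spread[OF \<nu>] by (metis zero_less_divide_iff zero_less_numeral)
  let ?I = "\<integral>y. spread (real n) y \<partial>\<nu>"
  \<comment> \<open>Keeps the penalty \<open>2 * n * \<eta>\<close> in
    \<open>diameter_le_spread\<close> below \<epsilon>/4; \<open>Suc n\<close> avoids division by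
    zero.\<close>
  define \<eta> where "\<eta> = \<epsilon> / (8 * real (Suc n))"
  have "\<eta> > 0" using \<open>\<epsilon> > 0\<close> by (simp add: \<eta>_def)
  have n\<eta>: "2 * real n * \<eta> \<le> \<epsilon> / 4" using \<open>\<epsilon> > 0\<close> by (simp add: \<eta>_def field_simps)
  obtain \<rho> where \<rho>: "\<rho> > 0"
    "\<And>a b k. a \<in> Y \<Longrightarrow> b \<in> Y \<Longrightarrow> dist a b < \<rho> \<Longrightarrow> dist ((S ^^ k) a) ((S ^^ k) b) < \<eta>"
    using base.uniform_equicontinuity[OF \<open>\<eta> > 0\<close>] by metis
  obtain \<delta> where \<delta>: "\<delta> > 0" "\<And>z. z \<in> X \<Longrightarrow> dist z x < \<delta> \<Longrightarrow> dist (f z) (f x) < \<rho>"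
    using cont_f x \<rho>(1) unfolding continuous_on_iff by metis
  have diam: "diameter ((T ^^ i) ` (ball x \<delta> \<inter> X)) \<le> spread (real n) ((S ^^ i) (f x)) + 2 * real n * \<eta>" for i
  proof (rule diameter_le_spread)
    show "(T ^^ i) ` (ball x \<delta> \<inter> X) \<subseteq> X" by (rule pow_image_subset) blast
    show "(S ^^ i) (f x) \<in> Y" by (rule base.pow_in[OF f_in[OF x]])
    fix w assume "w \<in> (T ^^ i) ` (ball x \<delta> \<inter> X)"
    then obtain z where z: "w = (T ^^ i) z" "z \<in> X" "dist z x < \<delta>" by (auto simp: dist_commute)
    then show "dist (f w) ((S ^^ i) (f x)) \<le> \<eta>"
      using \<rho>(2)[OF f_in f_in \<delta>(2)] x f_pow by (simp add: less_imp_le)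
  qed (use \<open>\<eta> > 0\<close> in auto)
  obtain n0 where n0: "\<And>k z. k \<ge> n0 \<Longrightarrow> z \<in> Y \<Longrightarrow>
    \<bar>(\<Sum>i<k. spread (real n) ((S ^^ i) z)) - real k * ?I\<bar> \<le> \<epsilon> / 4 * real k"
    using base.averages_converge_uniformly[OF \<nu> continuous_on_spread[of "real n"], of "\<epsilon> / 4"] \<open>\<epsilon> > 0\<close> by auto
  let ?A = "\<lambda>M N. (1 / real (N - M)) * (\<Sum>i=M+1..N. diameter ((T ^^ i) ` (ball x \<delta> \<inter> X)))"
  \<comment> \<open>Three errors of at most \<epsilon>/4 add up: the integral of
    \<open>spread\<close>, the deviation of the ergodic average from it, and the penalty. The
    average starts at \<open>(S ^^ Suc M) (f x)\<close>, and uniformity in the starting point makes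
    the bound independent of M.\<close>
  have avg: "?A M N \<le> 3 * \<epsilon> / 4" if MN: "M < N" "N - M \<ge> n0" for M N
  proof -
    let ?k = "N - M"
    have "(\<Sum>i=M+1..N. diameter ((T ^^ i) ` (ball x \<delta> \<inter> X)))
      \<le> (\<Sum>i=M+1..N. spread (real n) ((S ^^ i) (f x)) + 2 * real n * \<eta>)" by (intro sum_mono diam)
    also have "\<dots> = (\<Sum>i=M+1..M+?k. spread (real n) ((S ^^ i) (f x))) + real ?k * (2 * real n * \<eta>)"
      using MN(1) by (simp add: sum.distrib)
    also have "(\<Sum>i=M+1..M+?k. spread (real n) ((S ^^ i) (f x)))
      = (\<Sum>i<?k. spread (real n) ((S ^^ i) ((S ^^ Suc M) (f x))))" by (rule sum_shift_funpow)
    also have "\<dots> \<le> real ?k * ?I + \<epsilon> / 4 * real ?k"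
      using n0[OF MN(2) base.pow_in[OF f_in[OF x], of "Suc M"]] by linarith
    also have "real ?k * ?I \<le> real ?k * (\<epsilon> / 4)" using n by (intro mult_left_mono) auto
    also have "real ?k * (2 * real n * \<eta>) \<le> real ?k * (\<epsilon> / 4)" by (intro mult_left_mono n\<eta>) auto
    finally have "(\<Sum>i=M+1..N. diameter ((T ^^ i) ` (ball x \<delta> \<inter> X))) \<le> 3 * \<epsilon> / 4 * real ?k"
      by (simp add: algebra_simps)
    then show ?thesis using MN(1) by (simp add: divide_le_eq)
  qed
  have "limsup (\<lambda>k. SUP (M, N) \<in> {(M, N). M < N \<and> N - M = k}. ereal (?A M N)) \<le> ereal (3 * \<epsilon> / 4)"
  proof (rule Limsup_bounded)
    show "\<forall>\<^sub>F k in sequentially. (SUP (M, N) \<in> {(M, N). M < N \<and> N - M = k}. ereal (?A M N)) \<le> ereal (3 * \<epsilon> / 4)"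
      using eventually_ge_at_top[of n0]
    proof eventually_elim
      case (elim k)
      then show ?case by (intro SUP_least) (use avg in auto)
    qed
  qed
  also have "\<dots> < ereal \<epsilon>" using \<open>\<epsilon> > 0\<close> by simp
  finally show "\<exists>\<delta>>0. limsup (\<lambda>n. SUP (M, N) \<in> {(M, N). M < N \<and> N - M = n}.
            ereal ((1 / real (N - M)) * (\<Sum>i=M+1..N. diameter ((T ^^ i) ` (ball x \<delta> \<inter> X))))) < ereal \<epsilon>"
    using \<delta>(1) by blast
qed

end

theorem theorem4p12:
  fixes X :: "'a::metric_space set" and T :: "'a \<Rightarrow> 'a"
    and X_eq :: "'b::metric_space set" and T_eq :: "'b \<Rightarrow> 'b"
    and \<pi>_eq :: "'a \<Rightarrow> 'b" and \<nu>_eq :: "'b measure"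
  assumes "minimal_tds X T"
    and "maximal_equicontinuous_factor X T X_eq T_eq \<pi>_eq"
    and "invariant_borel_prob X_eq T_eq \<nu>_eq"
  shows "(diam_mean_equicontinuous X T \<longleftrightarrow> Banach_diam_mean_equicontinuous X T) \<and>
         (Banach_diam_mean_equicontinuous X T \<longleftrightarrow> regular_factor_map X X_eq \<nu>_eq \<pi>_eq)"
proof -
  have factor: "factor_map X T X_eq T_eq \<pi>_eq" and eq: "equicontinuous_tds X_eq T_eq"
    using assms(2) by (auto simp: maximal_equicontinuous_factor_def)
  \<comment> \<open>A probability measure has a nonempty space.\<close>
  have "X_eq \<noteq> {}"
  proof
    assume "X_eq = {}"
    then have "space \<nu>_eq = {}"
      using assms(3) sets_eq_imp_space_eq[of \<nu>_eq "restrict_space borel X_eq"]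
      by (simp add: invariant_borel_prob_def space_restrict_space)
    then show False using assms(3) prob_space.not_empty by (auto simp: invariant_borel_prob_def)
  qed
  moreover from this have "X \<noteq> {}" using factor by (auto simp: factor_map_def)
  ultimately interpret minimal_extension X T X_eq T_eq \<pi>_eq
    using assms(1) factor_minimal_tds[OF assms(1) factor] factor eq by unfold_locales
  \<comment> \<open>The implications form a cycle: Banach diam-mean, diam-mean, regular, Banach
    diam-mean.\<close>
  show ?thesis
    using Banach_imp_diam_mean_equicontinuous diam_mean_imp_regular[OF assms(2) _ assms(3)]
      regular_imp_Banach_diam_mean[OF assms(3)] by blast
qed

end
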